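(* There is an algorithm which, given a simple LQCA $A=(\Sigma,q,N,\delta)$ with $|N|=r$, decides whether $A$ is well-formed, and runs in time $O(n^2)$ in the algebraic model of computation, where $n=|\Sigma|^{r+1}$ is the size of $A$.
   Context: A linear quantum cellular automaton (LQCA) is a tuple $A=(\Sigma,q,N,\delta)$ where $\Sigma$ is a finite nonempty set of states, $N=(a_1,\dots,a_r)$ ($r\ge1$) is a strictly increasing sequence of integers, $\delta:\Sigma^r\to\mathbb C^\Sigma$ satisfies $\|\delta(w)\|>0$ for all $w$, and $q\in\Sigma$ satisfies $[\delta(q,\dots,q)](x)=1$ if $x=q$ and $0$ otherwise. It is simple if $a_r-a_1=r-1$. The input is the table of $\delta$ (of size $|\Sigma|^{r+1}$). In the algebraic model, complex numbers occupy unit space and arithmetic operations and comparisons take unit time. A configuration is a map $c:\mathbb Z\to\Sigma$ with $c_i\ne q$ for only finitely many $i$; $\mathcal C_A$ is the set of configurations. With $c_{i+N}=(c_{i+a_1},\dots,c_{i+a_r})$, the time evolution operator is $U_A(d,c)=\prod_{i\in\mathbb Z}[\delta(c_{i+N})](d_i)$, viewed as a linear operator on $\ell_2(\mathcal C_A)$. $A$ is well-formed if $U_A$ preserves the $\ell_2$ norm, equivalently if the columns $U_A(\cdot,c)$ are orthonormal. *)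

theory Defs
  imports "HOL-Analysis.Analysis"
begin

text \<open>States are encoded as Sigma = {0..<k}; the local map delta takes a list
  of r neighbour states and yields a vector in C^Sigma (a function nat => complex,
  only values below k are relevant).  The neighbourhood of a simple LQCA is
  N = (a, a+1, ..., a+r-1).\<close>

definition is_LQCA :: "nat \<Rightarrow> nat \<Rightarrow> nat \<Rightarrow> (nat list \<Rightarrow> nat \<Rightarrow> complex) \<Rightarrow> bool" where
  "is_LQCA k r q \<delta> \<longleftrightarrow> 1 \<le> k \<and> 1 \<le> r \<and> q < k \<and>
     (\<forall>w. length w = r \<and> set w \<subseteq> {..<k} \<longrightarrow> (\<exists>x<k. \<delta> w x \<noteq> 0)) \<and>
     (\<forall>x<k. \<delta> (replicate r q) x = (if x = q then 1 else 0))"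

definition is_config :: "nat \<Rightarrow> nat \<Rightarrow> (int \<Rightarrow> nat) \<Rightarrow> bool" where
  "is_config k q c \<longleftrightarrow> (\<forall>i. c i < k) \<and> finite {i. c i \<noteq> q}"

definition nbh :: "int \<Rightarrow> nat \<Rightarrow> (int \<Rightarrow> nat) \<Rightarrow> int \<Rightarrow> nat list" where
  "nbh a r c i = map (\<lambda>j. c (i + a + int j)) [0..<r]"

text \<open>U_A(d,c) = prod over all i in Z of delta(c_{i+N})(d_i); for configurations
  all but finitely many factors equal 1, so this is the finite product of the
  factors different from 1.\<close>
definition U :: "int \<Rightarrow> nat \<Rightarrow> (nat list \<Rightarrow> nat \<Rightarrow> complex) \<Rightarrow> (int \<Rightarrow> nat) \<Rightarrow> (int \<Rightarrow> nat) \<Rightarrow> complex" where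
  "U a r \<delta> d c = (\<Prod>i\<in>{i. \<delta> (nbh a r c i) (d i) \<noteq> 1}. \<delta> (nbh a r c i) (d i))"

definition well_formed :: "nat \<Rightarrow> nat \<Rightarrow> int \<Rightarrow> nat \<Rightarrow> (nat list \<Rightarrow> nat \<Rightarrow> complex) \<Rightarrow> bool" where
  "well_formed k q a r \<delta> \<longleftrightarrow>
     (\<forall>c c'. is_config k q c \<and> is_config k q c' \<longrightarrow>
        ((\<lambda>d. U a r \<delta> d c * cnj (U a r \<delta> d c')) has_sum (if c = c' then 1 else 0))
          {d. is_config k q d})"

text \<open>Complex registers C (unit cost arithmetic, conjugation, real/imaginary part,
  comparisons), natural-number index registers N with addition/subtraction only,
  indirect addressing, jumps.  Every instruction costs one time step.\<close>

datatype instr =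
    CConst nat complex
  | CAdd nat nat nat | CSub nat nat nat | CMul nat nat nat | CDiv nat nat nat
  | CConj nat nat | CRe nat nat | CIm nat nat
  | COfNat nat nat
  | CLoad nat nat
  | CStore nat nat
  | NConst nat nat
  | NAdd nat nat nat | NSub nat nat nat
  | NLoad nat nat
  | NStore nat nat
  | JmpCEq nat nat nat
  | JmpCLe nat nat nat
  | JmpNLe nat nat nat
  | Goto nat
  | Halt bool

record mstate =
  pc :: nat
  creg :: "nat \<Rightarrow> complex"
  nreg :: "nat \<Rightarrow> nat"
  out :: "bool option"

fun exec :: "instr \<Rightarrow> mstate \<Rightarrow> mstate" where
  "exec (CConst i z) s = s\<lparr>creg := (creg s)(i := z), pc := Suc (pc s)\<rparr>"
| "exec (CAdd i j l) s = s\<lparr>creg := (creg s)(i := creg s j + creg s l), pc := Suc (pc s)\<rparr>"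
| "exec (CSub i j l) s = s\<lparr>creg := (creg s)(i := creg s j - creg s l), pc := Suc (pc s)\<rparr>"
| "exec (CMul i j l) s = s\<lparr>creg := (creg s)(i := creg s j * creg s l), pc := Suc (pc s)\<rparr>"
| "exec (CDiv i j l) s = s\<lparr>creg := (creg s)(i := creg s j / creg s l), pc := Suc (pc s)\<rparr>"
| "exec (CConj i j) s = s\<lparr>creg := (creg s)(i := cnj (creg s j)), pc := Suc (pc s)\<rparr>"
| "exec (CRe i j) s = s\<lparr>creg := (creg s)(i := complex_of_real (Re (creg s j))), pc := Suc (pc s)\<rparr>"
| "exec (CIm i j) s = s\<lparr>creg := (creg s)(i := complex_of_real (Im (creg s j))), pc := Suc (pc s)\<rparr>"
| "exec (COfNat i j) s = s\<lparr>creg := (creg s)(i := of_nat (nreg s j)), pc := Suc (pc s)\<rparr>"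
| "exec (CLoad i j) s = s\<lparr>creg := (creg s)(i := creg s (nreg s j)), pc := Suc (pc s)\<rparr>"
| "exec (CStore i j) s = s\<lparr>creg := (creg s)(nreg s j := creg s i), pc := Suc (pc s)\<rparr>"
| "exec (NConst i n) s = s\<lparr>nreg := (nreg s)(i := n), pc := Suc (pc s)\<rparr>"
| "exec (NAdd i j l) s = s\<lparr>nreg := (nreg s)(i := nreg s j + nreg s l), pc := Suc (pc s)\<rparr>"
| "exec (NSub i j l) s = s\<lparr>nreg := (nreg s)(i := nreg s j - nreg s l), pc := Suc (pc s)\<rparr>"
| "exec (NLoad i j) s = s\<lparr>nreg := (nreg s)(i := nreg s (nreg s j)), pc := Suc (pc s)\<rparr>"
| "exec (NStore i j) s = s\<lparr>nreg := (nreg s)(nreg s j := nreg s i), pc := Suc (pc s)\<rparr>"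
| "exec (JmpCEq i j t) s = s\<lparr>pc := (if creg s i = creg s j then t else Suc (pc s))\<rparr>"
| "exec (JmpCLe i j t) s = s\<lparr>pc := (if Re (creg s i) \<le> Re (creg s j) then t else Suc (pc s))\<rparr>"
| "exec (JmpNLe i j t) s = s\<lparr>pc := (if nreg s i \<le> nreg s j then t else Suc (pc s))\<rparr>"
| "exec (Goto t) s = s\<lparr>pc := t\<rparr>"
| "exec (Halt b) s = s\<lparr>out := Some b\<rparr>"

definition step :: "instr list \<Rightarrow> mstate \<Rightarrow> mstate" where
  "step prog s = (if out s = None \<and> pc s < length prog then exec (prog ! pc s) s else s)"

fun digits :: "nat \<Rightarrow> nat \<Rightarrow> nat \<Rightarrow> nat list" where
  "digits k 0 m = []"
| "digits k (Suc l) m = digits k l (m div k) @ [m mod k]"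

text \<open>Input: the table of delta (size k^(r+1)) in C[0..k^(r+1)-1], where cell m
  holds delta(w)(x) for w @ [x] = base-k digits of m; N[0]=k, N[1]=r, N[2]=q.\<close>
definition init :: "nat \<Rightarrow> nat \<Rightarrow> nat \<Rightarrow> (nat list \<Rightarrow> nat \<Rightarrow> complex) \<Rightarrow> mstate" where
  "init k r q \<delta> = \<lparr> pc = 0,
     creg = (\<lambda>m. if m < k ^ (r + 1)
                  then (let ds = digits k (r + 1) m in \<delta> (butlast ds) (last ds)) else 0),
     nreg = (\<lambda>m. if m = 0 then k else if m = 1 then r else if m = 2 then q else 0),
     out = None \<rparr>"

end

theory Submission
  imports Defs
begin

text \<open>The inner product of two columns factors over the cells, because outside a finite window every
  cell contributes 1: it is the product of the inner products \<open>gram e e'\<close> of the vectors that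
  \<open>\<delta>\<close> assigns to the windows \<open>e\<close>, \<open>e'\<close> of the two configurations. Windows are the edges of the
  de Bruijn graph on the words of length \<open>r - 1\<close>, and configurations are closed walks through the
  quiescent word. Hence all columns have norm 1 iff all closed walks have weight 1, that is, iff the
  edge weights come from a vertex potential; since all weights are nonzero this is checked by
  computing the potential along a spanning tree and testing every edge. Distinct columns are
  orthogonal iff no pair of walks with nonzero \<open>gram\<close> values leaves the diagonal of the pair graph
  and comes back, i.e. no two distinct edges with a common target and nonzero \<open>gram\<close> value start at
  a pair of vertices reachable from the diagonal. The search visits each of the \<open>k ^ (2 * r)\<close> pairs
  of edges at most once and spends \<open>O(k)\<close> steps on each.\<close>


section \<open>A structured language over the register machine\<close>

text \<open>The machine dictates the shape of the program. Index registers can be added and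
  subtracted but neither multiplied nor divided, while a pair of edges may cost only
  \<open>O(k)\<close>. So residues, quotients and row addresses of single edges are tabulated once,
  in time linear in \<open>k ^ r\<close>, and the search gets by with look-ups and additions. Its
  cost of about \<open>k ^ (2 * r) * k\<close> stays below the square \<open>k ^ (2 * r + 2)\<close>
  of the input size. Counted loops are enough: a queue without repetitions holds at most
  \<open>V * V\<close> vertex pairs, so \<open>V * V\<close> rounds, some of them idle, replace a
  search that stops when the queue is exhausted. This makes every running time an explicit
  expression. The two halves of the criterion interact in one place. To turn a pair of merging walks
  into two configurations, the merged walk must return to the quiescent word, and this return along
  the diagonal has nonzero weight.\<close>

datatype test = TLe nat nat | TEq nat nat

datatype com =
    Skip
  | Prim instr
  | ALoad nat nat nat
  | AStore nat nat nat
  | Seq com com  (infixr ";;" 60)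
  | If test com com
  | For nat nat com

fun jump :: "test \<Rightarrow> nat \<Rightarrow> instr" where
  "jump (TLe i j) t = JmpNLe i j t"
| "jump (TEq i j) t = JmpCEq i j t"

text \<open>The start address \<open>p\<close> is a parameter because jump targets are absolute. An
  array address needs \<open>8 * x\<close>, obtained by three doublings in the absence of
  multiplication. In a conditional the else branch comes first, reached by falling through, so a
  false test costs one step more than a true one.\<close>

fun compile :: "com \<Rightarrow> nat \<Rightarrow> instr list" where
  "compile Skip p = []"
| "compile (Prim i) p = [i]"
| "compile (ALoad d j x) p =
     [NAdd 30 x x, NAdd 30 30 30, NAdd 30 30 30, NConst 29 (32 + j), NAdd 30 30 29, NLoad d 30]"
| "compile (AStore j x d) p =
     [NAdd 30 x x, NAdd 30 30 30, NAdd 30 30 30, NConst 29 (32 + j), NAdd 30 30 29, NStore d 30]"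
| "compile (a ;; b) p = compile a p @ compile b (p + length (compile a p))"
| "compile (If t a b) p =
     (let cb = compile b (p + 1); pa = p + 2 + length cb; ca = compile a pa
      in jump t pa # cb @ Goto (pa + length ca) # ca)"
| "compile (For i b c) p =
     (let cc = compile c (p + 2)
      in NConst i 0 # JmpNLe b i (p + 5 + length cc) # cc @ [NConst 31 1, NAdd i i 31, Goto (p + 1)])"

type_synonym cmem = "nat \<Rightarrow> complex"
type_synonym nmem = "nat \<Rightarrow> nat"
type_synonym amem = "nat \<Rightarrow> nat \<Rightarrow> nat"

text \<open>The index memory is seen as 29 registers and 8 interleaved unbounded arrays; cells 29, 30, 31
  are scratch space of the compiled code.\<close>
definition rep :: "nmem \<Rightarrow> nmem \<Rightarrow> amem \<Rightarrow> bool" where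
  "rep N R A \<longleftrightarrow> (\<forall>i<29. N i = R i) \<and> (\<forall>i. \<forall>j<8. N (32 + 8 * i + j) = A j i)"

text \<open>Index operands below 29 keep primitive instructions away from the scratch cells and the
  arrays. Raw \<open>NLoad\<close> and \<open>NStore\<close> are excluded, so indirect access to
  index cells goes through the arrays alone.\<close>

fun prim_ok :: "instr \<Rightarrow> bool" where
  "prim_ok (CConst i z) = True"
| "prim_ok (CAdd i j l) = True"
| "prim_ok (CMul i j l) = True"
| "prim_ok (CConj i j) = True"
| "prim_ok (CLoad i j) = (j < 29)"
| "prim_ok (CStore i j) = (j < 29)"
| "prim_ok (NConst i n) = (i < 29)"
| "prim_ok (NAdd i j l) = (i < 29 \<and> j < 29 \<and> l < 29)"
| "prim_ok (NSub i j l) = (i < 29 \<and> j < 29 \<and> l < 29)"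
| "prim_ok _ = False"

fun prim_c :: "instr \<Rightarrow> cmem \<Rightarrow> nmem \<Rightarrow> cmem" where
  "prim_c (CConst i z) C R = C(i := z)"
| "prim_c (CAdd i j l) C R = C(i := C j + C l)"
| "prim_c (CMul i j l) C R = C(i := C j * C l)"
| "prim_c (CConj i j) C R = C(i := cnj (C j))"
| "prim_c (CLoad i j) C R = C(i := C (R j))"
| "prim_c (CStore i j) C R = C(R j := C i)"
| "prim_c _ C R = C"

fun prim_n :: "instr \<Rightarrow> nmem \<Rightarrow> nmem" where
  "prim_n (NConst i n) R = R(i := n)"
| "prim_n (NAdd i j l) R = R(i := R j + R l)"
| "prim_n (NSub i j l) R = R(i := R j - R l)"
| "prim_n _ R = R"

fun test_ok :: "test \<Rightarrow> bool" where
  "test_ok (TLe i j) = (i < 29 \<and> j < 29)"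
| "test_ok (TEq i j) = True"

fun holds :: "test \<Rightarrow> cmem \<Rightarrow> nmem \<Rightarrow> bool" where
  "holds (TLe i j) C R = (R i \<le> R j)"
| "holds (TEq i j) C R = (C i = C j)"

section \<open>Placement of compiled code and rules for its timed execution\<close>

definition code_at :: "instr list \<Rightarrow> nat \<Rightarrow> instr list \<Rightarrow> bool" where
  "code_at prog p xs \<longleftrightarrow> (\<exists>ys zs. prog = ys @ xs @ zs \<and> length ys = p)"

lemma code_at_append:
  assumes "code_at prog p (xs @ ys)"
  shows "code_at prog p xs" "code_at prog (p + length xs) ys"
proof -
  obtain us vs where *: "prog = us @ (xs @ ys) @ vs" "length us = p"
    using assms unfolding code_at_def by blast
  show "code_at prog p xs"
    unfolding code_at_def using * by (metis append.assoc)
  show "code_at prog (p + length xs) ys"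
    unfolding code_at_def using * by (metis append.assoc length_append)
qed

lemma code_at_Cons:
  assumes "code_at prog p (x # xs)"
  shows "p < length prog" "prog ! p = x" "code_at prog (Suc p) xs"
proof -
  obtain us vs where *: "prog = us @ (x # xs) @ vs" "length us = p"
    using assms unfolding code_at_def by blast
  show "p < length prog" "prog ! p = x" using * by (auto simp: nth_append)
  show "code_at prog (Suc p) xs"
    unfolding code_at_def using * by (metis append.assoc append_Cons append_Nil length_append_singleton)
qed

abbreviation mst :: "nat \<Rightarrow> cmem \<Rightarrow> nmem \<Rightarrow> mstate" where
  "mst p C N \<equiv> \<lparr>pc = p, creg = C, nreg = N, out = None\<rparr>"

text \<open>Weakest precondition with time credits: the code terminates within \<open>T\<close> steps, and \<open>Q\<close> also
  receives the credits that are left over.\<close>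
definition wp ::
  "com \<Rightarrow> nat \<Rightarrow> cmem \<Rightarrow> nmem \<Rightarrow> amem \<Rightarrow> (nat \<Rightarrow> cmem \<Rightarrow> nmem \<Rightarrow> amem \<Rightarrow> bool) \<Rightarrow> bool" where
  "wp c T C R A Q \<longleftrightarrow>
     (\<forall>prog p N. code_at prog p (compile c p) \<longrightarrow> rep N R A \<longrightarrow>
        (\<exists>t\<le>T. \<exists>C' N' R' A'.
           (step prog ^^ t) (mst p C N) = mst (p + length (compile c p)) C' N' \<and>
           rep N' R' A' \<and> Q (T - t) C' R' A'))"

lemma steps_append:
  "(step prog ^^ t) s = s' \<Longrightarrow> (step prog ^^ t') s' = s'' \<Longrightarrow> (step prog ^^ (t + t')) s = s''"
  by (simp add: add.commute[of t] funpow_add)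

lemma steps_Suc: "(step prog ^^ Suc t) s = (step prog ^^ t) (step prog s)"
  by (simp add: funpow_swap1)

lemma step_code:
  assumes "code_at prog p (x # xs)"
  shows "step prog (mst p C N) = exec x (mst p C N)"
  using code_at_Cons[OF assms] by (simp add: step_def)

fun straight :: "instr \<Rightarrow> bool" where
  "straight (JmpCEq i j t) = False"
| "straight (JmpCLe i j t) = False"
| "straight (JmpNLe i j t) = False"
| "straight (Goto t) = False"
| "straight (Halt b) = False"
| "straight _ = True"

lemma steps_straight:
  assumes "code_at prog p (xs @ ys)" "list_all straight xs"
  shows "(step prog ^^ length xs) (mst p C N) = fold exec xs (mst p C N)"
  using assms
proof (induction xs arbitrary: p C N)
  case (Cons x xs)
  have "code_at prog p (x # (xs @ ys))" using Cons.prems by simp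
  note c = step_code[OF this] code_at_Cons(3)[OF this]
  obtain C' N' where e: "exec x (mst p C N) = mst (Suc p) C' N'"
    using Cons.prems by (cases x) auto
  show ?case
    using Cons.IH[OF c(2)] Cons.prems unfolding length_Cons steps_Suc c(1) e by (simp add: e)
qed simp

lemma wp_Skip: "Q T C R A \<Longrightarrow> wp Skip T C R A Q"
  unfolding wp_def
  by (intro allI impI exI[of _ "0::nat"] conjI exI) auto

lemma rep_reg: "rep N R A \<Longrightarrow> i < 29 \<Longrightarrow> N i = R i"
  by (simp add: rep_def)

lemma rep_upd: "rep N R A \<Longrightarrow> i < 29 \<Longrightarrow> rep (N(i := x)) (R(i := x)) A"
  by (auto simp: rep_def)

lemma rep_scratch: "rep N R A \<Longrightarrow> i \<in> {29, 30, 31} \<Longrightarrow> rep (N(i := x)) R A"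
  by (auto simp: rep_def)

lemma array_address_inj:
  assumes "(32::nat) + 8 * i + j = 32 + 8 * i' + j'" "j < 8" "j' < 8"
  shows "i = i'" "j = j'"
proof -
  have "8 * i + j = 8 * i' + j'" using assms(1) by simp
  then show "i = i'" using assms(2,3) by linarith
  with assms(1) show "j = j'" by simp
qed

lemma rep_store:
  assumes "rep N R A" "j < 8"
  shows "rep (N(32 + 8 * i + j := x)) R (A(j := (A j)(i := x)))"
  using assms array_address_inj[of i j] array_address_inj[of _ _ i j] unfolding rep_def
  by (auto simp: fun_upd_def)

lemma wp_Prim:
  assumes "prim_ok i" "1 \<le> T" "Q (T - 1) (prim_c i C R) (prim_n i R) A"
  shows "wp (Prim i) T C R A Q"
  unfolding wp_def
proof (intro allI impI)
  fix prog p N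
  assume c: "code_at prog p (compile (Prim i) p)" and r: "rep N R A"
  have "exec i (mst p C N) = mst (Suc p) (prim_c i C R) (nreg (exec i (mst p C N)))
     \<and> rep (nreg (exec i (mst p C N))) (prim_n i R) A"
    using assms(1) r by (cases i) (auto simp: rep_reg rep_upd)
  then show "\<exists>t\<le>T. \<exists>C' N' R' A'.
           (step prog ^^ t) (mst p C N) = mst (p + length (compile (Prim i) p)) C' N' \<and>
           rep N' R' A' \<and> Q (T - t) C' R' A'"
    using assms(2,3) step_code[of prog p i "[]"] c
    by (intro exI[of _ 1] conjI exI) auto
qed

lemma wp_ALoad:
  assumes "d < 29" "j < 8" "x < 29" "6 \<le> T" "Q (T - 6) C (R(d := A j (R x))) A"
  shows "wp (ALoad d j x) T C R A Q"
  unfolding wp_def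
proof (intro allI impI)
  fix prog p N
  assume c: "code_at prog p (compile (ALoad d j x) p)" and r: "rep N R A"
  let ?a = "32 + 8 * R x + j"
  let ?N = "N(29 := 32 + j, 30 := ?a, d := A j (R x))"
  have a: "A j (R x) = N ?a" using r assms(2) by (simp add: rep_def)
  have "(step prog ^^ 6) (mst p C N) = mst (p + 6) C ?N"
  proof -
    have "length (compile (ALoad d j x) p) = 6" "list_all straight (compile (ALoad d j x) p)" by simp_all
    moreover have "fold exec (compile (ALoad d j x) p) (mst p C N) = mst (p + 6) C ?N"
      using c a rep_reg[OF r assms(3)] by (simp add: algebra_simps)
    ultimately show ?thesis
      using steps_straight[of prog p "compile (ALoad d j x) p" "[]" C N] c by (simp del: compile.simps)
  qed
  moreover have "rep ?N (R(d := A j (R x))) A"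
    using r assms(1) by (intro rep_upd rep_scratch) auto
  ultimately show "\<exists>t\<le>T. \<exists>C' N' R' A'.
           (step prog ^^ t) (mst p C N) = mst (p + length (compile (ALoad d j x) p)) C' N' \<and>
           rep N' R' A' \<and> Q (T - t) C' R' A'"
    using assms(4,5) by (intro exI[of _ 6] conjI exI) auto
qed

lemma wp_AStore:
  assumes "d < 29" "j < 8" "x < 29" "6 \<le> T" "Q (T - 6) C R (A(j := (A j)(R x := R d)))"
  shows "wp (AStore j x d) T C R A Q"
  unfolding wp_def
proof (intro allI impI)
  fix prog p N
  assume c: "code_at prog p (compile (AStore j x d) p)" and r: "rep N R A"
  let ?a = "32 + 8 * R x + j"
  let ?N = "N(29 := 32 + j, 30 := ?a, ?a := R d)"
  have "(step prog ^^ 6) (mst p C N) = mst (p + 6) C ?N"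
  proof -
    have "length (compile (AStore j x d) p) = 6" "list_all straight (compile (AStore j x d) p)" by simp_all
    moreover have "fold exec (compile (AStore j x d) p) (mst p C N) = mst (p + 6) C ?N"
      using rep_reg[OF r assms(3)] rep_reg[OF r assms(1)] assms(1) by (simp add: algebra_simps)
    ultimately show ?thesis
      using steps_straight[of prog p "compile (AStore j x d) p" "[]" C N] c by (simp del: compile.simps)
  qed
  moreover have "rep ?N R (A(j := (A j)(R x := R d)))"
    using r assms(2) by (intro rep_store rep_scratch) auto
  ultimately show "\<exists>t\<le>T. \<exists>C' N' R' A'.
           (step prog ^^ t) (mst p C N) = mst (p + length (compile (AStore j x d) p)) C' N' \<and>
           rep N' R' A' \<and> Q (T - t) C' R' A'"
    using assms(4,5) by (intro exI[of _ 6] conjI exI) auto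
qed

lemma wp_Seq:
  assumes "wp a T C R A (\<lambda>T C R A. wp b T C R A Q)"
  shows "wp (a ;; b) T C R A Q"
  unfolding wp_def
proof (intro allI impI)
  fix prog p N
  assume c: "code_at prog p (compile (a ;; b) p)" and r: "rep N R A"
  let ?p = "p + length (compile a p)"
  have c1: "code_at prog p (compile a p)" and c2: "code_at prog ?p (compile b ?p)"
    using code_at_append[of prog p "compile a p" "compile b ?p"] c by auto
  obtain t C' N' R' A' where 1: "t \<le> T" "(step prog ^^ t) (mst p C N) = mst ?p C' N'"
     "rep N' R' A'" "wp b (T - t) C' R' A' Q"
    using assms c1 r unfolding wp_def[of a] by blast
  obtain t' C'' N'' R'' A'' where 2: "t' \<le> T - t"
     "(step prog ^^ t') (mst ?p C' N') = mst (?p + length (compile b ?p)) C'' N''"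
     "rep N'' R'' A''" "Q (T - t - t') C'' R'' A''"
    using 1(3,4) c2 unfolding wp_def by blast
  show "\<exists>t\<le>T. \<exists>C' N' R' A'.
           (step prog ^^ t) (mst p C N) = mst (p + length (compile (a ;; b) p)) C' N' \<and>
           rep N' R' A' \<and> Q (T - t) C' R' A'"
    using 1 2 steps_append[OF 1(2) 2(2)] by (intro exI[of _ "t + t'"] conjI exI) (auto simp: add.assoc)
qed

lemma wp_If:
  assumes "test_ok t" "2 \<le> T"
    and "holds t C R \<Longrightarrow> wp a (T - 1) C R A Q" "\<not> holds t C R \<Longrightarrow> wp b (T - 2) C R A Q"
  shows "wp (If t a b) T C R A Q"
  unfolding wp_def
proof (intro allI impI)
  fix prog p N
  assume c: "code_at prog p (compile (If t a b) p)" and r: "rep N R A"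
  let ?cb = "compile b (p + 1)"
  let ?pa = "p + 2 + length ?cb"
  let ?ca = "compile a ?pa"
  have c0: "code_at prog p (jump t ?pa # ?cb @ Goto (?pa + length ?ca) # ?ca)"
    using c by (simp add: Let_def)
  have cb: "code_at prog (p + 1) ?cb" and cg: "code_at prog (p + 1 + length ?cb) (Goto (?pa + length ?ca) # ?ca)"
    using code_at_append[of prog "p + 1" ?cb] code_at_Cons(3)[OF c0] by auto
  have ca: "code_at prog ?pa ?ca" using code_at_Cons(3)[OF cg] by simp
  have j: "step prog (mst p C N) = mst (if holds t C R then ?pa else p + 1) C N"
    using step_code[OF c0] assms(1) by (cases t) (auto simp: rep_reg[OF r])
  show "\<exists>t'\<le>T. \<exists>C' N' R' A'.
           (step prog ^^ t') (mst p C N) = mst (p + length (compile (If t a b) p)) C' N' \<and>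
           rep N' R' A' \<and> Q (T - t') C' R' A'"
  proof (cases "holds t C R")
    case True
    obtain t' C' N' R' A' where 1: "t' \<le> T - 1"
       "(step prog ^^ t') (mst ?pa C N) = mst (?pa + length ?ca) C' N'"
       "rep N' R' A'" "Q (T - 1 - t') C' R' A'"
      using assms(3)[OF True] ca r unfolding wp_def by blast
    have "(step prog ^^ Suc t') (mst p C N) = mst (?pa + length ?ca) C' N'"
      unfolding steps_Suc j using True 1(2) by simp
    then show ?thesis using 1 assms(2)
      by (intro exI[of _ "Suc t'"] conjI exI) (auto simp: Let_def algebra_simps)
  next
    case False
    obtain t' C' N' R' A' where 1: "t' \<le> T - 2"
       "(step prog ^^ t') (mst (p + 1) C N) = mst (p + 1 + length ?cb) C' N'"
       "rep N' R' A'" "Q (T - 2 - t') C' R' A'"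
      using assms(4)[OF False] cb r unfolding wp_def by blast
    have g: "step prog (mst (p + 1 + length ?cb) C' N') = mst (?pa + length ?ca) C' N'"
      using step_code[OF cg] by simp
    have "(step prog ^^ Suc t') (mst p C N) = mst (p + 1 + length ?cb) C' N'"
      unfolding steps_Suc j using False 1(2) by simp
    then have "(step prog ^^ Suc (Suc t')) (mst p C N) = mst (?pa + length ?ca) C' N'"
      using g by simp
    then show ?thesis using 1 assms(2)
      by (intro exI[of _ "Suc (Suc t')"] conjI exI) (auto simp: Let_def algebra_simps numeral_2_eq_2)
  qed
qed

text \<open>Lets a specification with its own fixed budget \<open>T1\<close> be used inside a larger
  one; at least the difference \<open>T - T1\<close> is handed on.\<close>

lemma wp_conseq:
  assumes "wp c T1 C R A (\<lambda>_. Q')" "T1 \<le> T"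
    and "\<And>T' C R A. T - T1 \<le> T' \<Longrightarrow> Q' C R A \<Longrightarrow> Q T' C R A"
  shows "wp c T C R A Q"
  unfolding wp_def
proof (intro allI impI)
  fix prog p N
  assume "code_at prog p (compile c p)" "rep N R A"
  then obtain t C' N' R' A' where 1: "t \<le> T1"
     "(step prog ^^ t) (mst p C N) = mst (p + length (compile c p)) C' N'"
     "rep N' R' A'" "Q' C' R' A'"
    using assms(1) unfolding wp_def by blast
  then show "\<exists>t\<le>T. \<exists>C' N' R' A'.
           (step prog ^^ t) (mst p C N) = mst (p + length (compile c p)) C' N' \<and>
           rep N' R' A' \<and> Q (T - t) C' R' A'"
    using assms(2,3) by (intro exI[of _ t] conjI exI) auto
qed

lemma wp_For:
  assumes ok: "i < 29" "b < 29" "i \<noteq> b"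
    and init: "Inv 0 C (R(i := 0)) A"
    and body: "\<And>j C' R' A'. j < R b \<Longrightarrow> Inv j C' R' A' \<Longrightarrow> R' i = j \<Longrightarrow> R' b = R b \<Longrightarrow>
       wp c Tb C' R' A' (\<lambda>_ C'' R'' A''. R'' i = j \<and> R'' b = R b \<and> Inv (Suc j) C'' (R''(i := Suc j)) A'')"
  shows "wp (For i b c) ((Tb + 4) * R b + 2) C R A (\<lambda>_. Inv (R b))"
  unfolding wp_def
proof (intro allI impI)
  fix prog p N
  assume c: "code_at prog p (compile (For i b c) p)" and r: "rep N R A"
  let ?cc = "compile c (p + 2)"
  let ?e = "p + 5 + length ?cc"
  let ?n = "R b"
  let ?cl = "[NConst 31 1, NAdd i i 31, Goto (p + 1)]"
  have c0: "code_at prog p (NConst i 0 # JmpNLe b i ?e # ?cc @ ?cl)"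
    using c by (simp add: Let_def)
  note c1 = code_at_Cons(3)[OF c0]
  have cc: "code_at prog (p + 2) ?cc" and c2: "code_at prog (p + 2 + length ?cc) ?cl"
    using code_at_append[of prog "p + 2" ?cc] code_at_Cons(3)[OF c1] by auto
  have loop: "\<exists>t\<le>(Tb + 4) * m + 1. \<exists>C' N' R' A'. (step prog ^^ t) (mst (p + 1) C1 N1) = mst ?e C' N' \<and>
           rep N' R' A' \<and> Inv ?n C' R' A'"
    if "rep N1 R1 A1" "Inv j C1 R1 A1" "R1 i = j" "R1 b = ?n" "j + m = ?n" for m j C1 N1 R1 A1
    using that
  proof (induction m arbitrary: j C1 N1 R1 A1)
    case 0
    have "step prog (mst (p + 1) C1 N1) = mst ?e C1 N1"
      using step_code[OF c1] 0 ok by (simp add: rep_reg[OF 0(1)])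
    then show ?case using 0 by (intro exI[of _ 1] conjI exI) auto
  next
    case (Suc m)
    have s1: "step prog (mst (p + 1) C1 N1) = mst (p + 2) C1 N1"
      using step_code[OF c1] Suc.prems ok by (simp add: rep_reg[OF Suc.prems(1)])
    obtain t C2 N2 R2 A2 where 2: "t \<le> Tb"
       "(step prog ^^ t) (mst (p + 2) C1 N1) = mst (p + 2 + length ?cc) C2 N2" "rep N2 R2 A2"
       "R2 i = j" "R2 b = ?n" "Inv (Suc j) C2 (R2(i := Suc j)) A2"
      using body[of j C1 R1 A1] Suc.prems cc unfolding wp_def by fastforce
    let ?N3 = "N2(31 := 1, i := Suc j)"
    have s3: "(step prog ^^ 3) (mst (p + 2 + length ?cc) C2 N2) = mst (p + 1) C2 ?N3"
    proof -
      let ?q = "p + 2 + length ?cc"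
      have "(step prog ^^ 2) (mst ?q C2 N2) = mst (?q + 2) C2 ?N3"
        using steps_straight[of prog ?q "[NConst 31 1, NAdd i i 31]" "[Goto (p + 1)]" C2 N2] c2
          rep_reg[OF 2(3) ok(1)] 2(4) ok(1) by (simp add: numeral_2_eq_2)
      moreover have "code_at prog (?q + 2) [Goto (p + 1)]"
        using code_at_append(2)[of prog ?q "[NConst 31 1, NAdd i i 31]" "[Goto (p + 1)]"] c2 by simp
      then have "step prog (mst (?q + 2) C2 ?N3) = mst (p + 1) C2 ?N3"
        using step_code by simp
      ultimately show ?thesis
        using steps_append[of 2 prog _ _ 1] by simp
    qed
    have r3: "rep ?N3 (R2(i := Suc j)) A2"
      using 2(3) ok by (intro rep_upd rep_scratch) auto
    obtain t' C' N' R' A' where 4: "t' \<le> (Tb + 4) * m + 1"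
      "(step prog ^^ t') (mst (p + 1) C2 ?N3) = mst ?e C' N'" "rep N' R' A'" "Inv ?n C' R' A'"
      using Suc.IH[OF r3 2(6)] 2(5) ok Suc.prems(5) by (auto simp del: fun_upd_apply simp: fun_upd_same fun_upd_other)
    have "(step prog ^^ (Suc t + (3 + t'))) (mst (p + 1) C1 N1) = mst ?e C' N'"
      by (rule steps_append[OF _ steps_append[OF s3 4(2)]]) (unfold steps_Suc s1, rule 2(2))
    then show ?case using 2(1) 4 by (intro exI[of _ "Suc t + (3 + t')"] conjI exI) auto
  qed
  have s0: "step prog (mst p C N) = mst (p + 1) C (N(i := 0))"
    using step_code[OF c0] by simp
  obtain t C' N' R' A' where 5: "t \<le> (Tb + 4) * ?n + 1"
      "(step prog ^^ t) (mst (p + 1) C (N(i := 0))) = mst ?e C' N'" "rep N' R' A'" "Inv ?n C' R' A'"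
    using loop[of "N(i := 0)" "R(i := 0)" A 0 C ?n] rep_upd[OF r ok(1)] init ok by auto
  show "\<exists>t\<le>(Tb + 4) * ?n + 2. \<exists>C' N' R' A'.
           (step prog ^^ t) (mst p C N) = mst (p + length (compile (For i b c) p)) C' N' \<and>
           rep N' R' A' \<and> Inv ?n C' R' A'"
    using 5 by (intro exI[of _ "Suc t"] conjI exI) (auto simp: Let_def steps_Suc s0 algebra_simps simp del: funpow.simps)
qed

text \<open>Verification conditions: straight-line code is evaluated symbolically, loops are left to
  \<open>wp\<close>.\<close>
fun vc ::
  "com \<Rightarrow> nat \<Rightarrow> cmem \<Rightarrow> nmem \<Rightarrow> amem \<Rightarrow> (nat \<Rightarrow> cmem \<Rightarrow> nmem \<Rightarrow> amem \<Rightarrow> bool) \<Rightarrow> bool" where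
  "vc Skip T C R A Q = Q T C R A"
| "vc (Prim i) T C R A Q = (prim_ok i \<and> 1 \<le> T \<and> Q (T - 1) (prim_c i C R) (prim_n i R) A)"
| "vc (ALoad d j x) T C R A Q =
     (d < 29 \<and> j < 8 \<and> x < 29 \<and> 6 \<le> T \<and> Q (T - 6) C (R(d := A j (R x))) A)"
| "vc (AStore j x d) T C R A Q =
     (d < 29 \<and> j < 8 \<and> x < 29 \<and> 6 \<le> T \<and> Q (T - 6) C R (A(j := (A j)(R x := R d))))"
| "vc (a ;; b) T C R A Q = vc a T C R A (\<lambda>T C R A. vc b T C R A Q)"
| "vc (If t a b) T C R A Q =
     (test_ok t \<and> 2 \<le> T \<and>
      (if holds t C R then vc a (T - 1) C R A Q else vc b (T - 2) C R A Q))"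
| "vc (For i b c) T C R A Q = wp (For i b c) T C R A Q"

lemma wp_mono:
  assumes "wp c T C R A Q" "\<And>T C R A. Q T C R A \<Longrightarrow> Q' T C R A"
  shows "wp c T C R A Q'"
  unfolding wp_def
proof (intro allI impI)
  fix prog p N
  assume "code_at prog p (compile c p)" "rep N R A"
  then obtain t C' N' R' A' where 1: "t \<le> T"
     "(step prog ^^ t) (mst p C N) = mst (p + length (compile c p)) C' N'"
     "rep N' R' A'" "Q (T - t) C' R' A'"
    using assms(1) unfolding wp_def by blast
  then show "\<exists>t\<le>T. \<exists>C' N' R' A'.
           (step prog ^^ t) (mst p C N) = mst (p + length (compile c p)) C' N' \<and>
           rep N' R' A' \<and> Q' (T - t) C' R' A'"
    using assms(2) by (intro exI[of _ t] conjI exI) auto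
qed

lemma vc_wp: "vc c T C R A Q \<Longrightarrow> wp c T C R A Q"
proof (induction c arbitrary: T C R A Q)
  case (Seq a b)
  have "wp a T C R A (\<lambda>T C R A. vc b T C R A Q)" using Seq by simp
  then show ?case by (intro wp_Seq) (erule wp_mono, rule Seq.IH(2))
qed (auto intro!: wp_Skip wp_Prim wp_ALoad wp_AStore wp_If)

section \<open>Inner products of columns as walks in a de Bruijn graph\<close>

text \<open>A single state is kept out because \<open>v div k < v\<close> for positive
  \<open>v\<close>, and \<open>r < k ^ r\<close>, both need \<open>k\<close> to be at least
  2.\<close>

locale lqca =
  fixes k r q :: nat and \<delta> :: "nat list \<Rightarrow> nat \<Rightarrow> complex"
  assumes lqca: "is_LQCA k r q \<delta>" and two_states: "2 \<le> k"
begin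

lemma r_pos: "1 \<le> r" and q_less: "q < k"
  and quiescent: "x < k \<Longrightarrow> \<delta> (replicate r q) x = (if x = q then 1 else 0)"
  and delta_nonzero: "length w = r \<Longrightarrow> set w \<subseteq> {..<k} \<Longrightarrow> \<exists>x<k. \<delta> w x \<noteq> 0"
  using lqca by (auto simp: is_LQCA_def)

section \<open>Factorisation of the inner product of two columns\<close>

definition inner_word :: "nat list \<Rightarrow> nat list \<Rightarrow> complex" where
  "inner_word w w' = (\<Sum>x<k. \<delta> w x * cnj (\<delta> w' x))"

lemma U_finite_window:
  assumes "is_config k q d" "finite I" "\<And>i. i \<notin> I \<Longrightarrow> nbh a r c i = replicate r q"
  shows "U a r \<delta> d c = (if \<forall>i. i \<notin> I \<longrightarrow> d i = q then \<Prod>i\<in>I. \<delta> (nbh a r c i) (d i) else 0)"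
proof -
  let ?f = "\<lambda>i. \<delta> (nbh a r c i) (d i)"
  have dk: "d i < k" for i using assms(1) by (simp add: is_config_def)
  have out: "?f i = (if d i = q then 1 else 0)" if "i \<notin> I" for i
    using quiescent[OF dk] assms(3)[OF that] by simp
  have sub: "{i. ?f i \<noteq> 1} \<subseteq> I \<union> {i. d i \<noteq> q}" using out by auto
  \<comment> \<open>A product over an infinite set is 1 by convention, so a zero factor makes
    \<open>U\<close> vanish only once this set is known to be finite.\<close>
  have fin: "finite {i. ?f i \<noteq> 1}"
    by (rule finite_subset[OF sub]) (use assms in \<open>auto simp: is_config_def\<close>)
  show ?thesis
  proof (cases "\<forall>i. i \<notin> I \<longrightarrow> d i = q")
    case True
    then have "{i. ?f i \<noteq> 1} \<subseteq> I" using sub by auto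
    then have "U a r \<delta> d c = (\<Prod>i\<in>I. ?f i)"
      unfolding U_def by (intro prod.mono_neutral_left assms(2)) auto
    then show ?thesis using True by simp
  next
    case False
    then obtain i where "i \<notin> I" "d i \<noteq> q" by auto
    then have "?f i = 0" using out by auto
    then have "U a r \<delta> d c = 0"
      unfolding U_def using fin by (intro prod_zero) (auto intro!: exI[of _ i])
    then show ?thesis unfolding if_not_P[OF False] .
  qed
qed

text \<open>Every \<open>d\<close> that is not quiescent outside \<open>I\<close> contributes 0,
  which leaves the finitely many \<open>d\<close> supported in \<open>I\<close>. Over these, the
  product of sums expands into the sum over all choices of states
  (\<open>prod_sum_PiE\<close>).\<close>

lemma column_inner_product:
  assumes "finite I" "\<And>i. i \<notin> I \<Longrightarrow> nbh a r c i = replicate r q"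
    "\<And>i. i \<notin> I \<Longrightarrow> nbh a r c' i = replicate r q"
  shows "((\<lambda>d. U a r \<delta> d c * cnj (U a r \<delta> d c')) has_sum
     (\<Prod>i\<in>I. inner_word (nbh a r c i) (nbh a r c' i))) {d. is_config k q d}"
proof -
  let ?h = "\<lambda>d. \<Prod>i\<in>I. \<delta> (nbh a r c i) (d i) * cnj (\<delta> (nbh a r c' i) (d i))"
  let ?D = "{d. (\<forall>i. d i < k) \<and> (\<forall>i. i \<notin> I \<longrightarrow> d i = q)}"
  let ?ext = "\<lambda>g i. if i \<in> I then g i else q"
  have conf: "is_config k q d" if "d \<in> ?D" for d
  proof -
    have "{i. d i \<noteq> q} \<subseteq> I" using that by auto
    then show ?thesis using that assms(1) finite_subset by (auto simp: is_config_def)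
  qed
  have bij: "bij_betw ?ext (PiE I (\<lambda>_. {..<k})) ?D"
    by (rule bij_betwI[where g = "\<lambda>d. restrict d I"])
      (use q_less in \<open>auto simp: fun_eq_iff PiE_def extensional_def\<close>)
  have "(\<Prod>i\<in>I. inner_word (nbh a r c i) (nbh a r c' i))
     = (\<Sum>g\<in>PiE I (\<lambda>_. {..<k}). ?h g)"
    unfolding inner_word_def by (rule prod_sum_PiE) (use assms in auto)
  also have "\<dots> = (\<Sum>g\<in>PiE I (\<lambda>_. {..<k}). ?h (?ext g))"
    by (intro sum.cong prod.cong refl) auto
  also have "\<dots> = (\<Sum>d\<in>?D. ?h d)"
    by (rule sum.reindex_bij_betw[OF bij])
  finally have eq: "(\<Prod>i\<in>I. inner_word (nbh a r c i) (nbh a r c' i)) = (\<Sum>d\<in>?D. ?h d)" .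
  have "finite ?D"
    using bij_betw_finite[OF bij] assms(1) by (auto intro: finite_PiE)
  then have "(?h has_sum (\<Sum>d\<in>?D. ?h d)) ?D" by (rule has_sum_finite)
  moreover have "(?h has_sum (\<Sum>d\<in>?D. ?h d)) ?D \<longleftrightarrow>
    ((\<lambda>d. U a r \<delta> d c * cnj (U a r \<delta> d c')) has_sum (\<Sum>d\<in>?D. ?h d)) {d. is_config k q d}"
  proof (rule has_sum_cong_neutral)
    fix d assume "d \<in> {d. is_config k q d} - ?D"
    then have d: "is_config k q d" "\<not> (\<forall>i. i \<notin> I \<longrightarrow> d i = q)" by (auto simp: is_config_def)
    show "U a r \<delta> d c * cnj (U a r \<delta> d c') = 0"
      using U_finite_window[OF d(1) assms(1,2)] d(2) by simp
  next
    fix d assume "d \<in> ?D - {d. is_config k q d}"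
    then show "?h d = 0" using conf by blast
  next
    fix d assume "d \<in> ?D \<inter> {d. is_config k q d}"
    then have d: "is_config k q d" "\<forall>i. i \<notin> I \<longrightarrow> d i = q" by auto
    show "?h d = U a r \<delta> d c * cnj (U a r \<delta> d c')"
      using U_finite_window[OF d(1) assms(1,2)] U_finite_window[OF d(1) assms(1,3)] d(2)
      by (simp add: prod.distrib)
  qed
  ultimately show ?thesis using eq by simp
qed

section \<open>Configurations as walks on words of length \<open>r - 1\<close>\<close>

definition V :: nat where "V = k ^ (r - 1)"

lemma V_pos: "0 < V" using two_states by (simp add: V_def)

lemma k_pos: "0 < k" using two_states by simp

lemma k_V: "k * V = k ^ r"
  using r_pos by (simp add: V_def power_eq_if)

text \<open>The word \<open>c (i - l + 1), \<dots>, c i\<close> as a number in base \<open>k\<close>.\<close>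
fun window :: "(int \<Rightarrow> nat) \<Rightarrow> int \<Rightarrow> nat \<Rightarrow> nat" where
  "window c i 0 = 0"
| "window c i (Suc l) = k * window c (i - 1) l + c i"

lemma digits_window:
  assumes "\<And>i. c i < k"
  shows "digits k l (window c i l) = map (\<lambda>j. c (i - int l + 1 + int j)) [0..<l]"
proof (induction l arbitrary: i)
  case (Suc l)
  have "(k * window c (i - 1) l + c i) div k = window c (i - 1) l"
       "(k * window c (i - 1) l + c i) mod k = c i"
    using assms[of i] by auto
  then show ?case using Suc[of "i - 1"] by (simp add: algebra_simps)
qed simp

lemma window_less:
  assumes "\<And>i. c i < k"
  shows "window c i l < k ^ l"
proof (induction l arbitrary: i)
  case (Suc l)
  have "k * window c (i - 1) l + c i < k * (window c (i - 1) l + 1)"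
    using assms[of i] by simp
  also have "\<dots> \<le> k * k ^ l" using Suc[of "i - 1"] by (intro mult_le_mono2) simp
  finally show ?case by simp
qed simp

lemma window_mod:
  assumes "\<And>i. c i < k"
  shows "window c i (Suc l) mod k ^ l = window c i l"
proof (induction l arbitrary: i)
  case (Suc l)
  have "window c i (Suc (Suc l)) mod k ^ Suc l
      = k * (window c (i - 1) (Suc l) mod k ^ l) + c i"
    using assms[of i] mod_mult2_eq[of "k * window c (i - 1) (Suc l) + c i" k "k ^ l"] by simp
  then show ?case using Suc[of "i - 1"] by simp
qed simp

definition gram :: "nat \<Rightarrow> nat \<Rightarrow> complex" where
  "gram e e' = inner_word (digits k r e) (digits k r e')"

text \<open>The step of the de Bruijn graph: \<open>k * u + x\<close> appends the letter
  \<open>x\<close> to the word \<open>u\<close>, and the residue modulo \<open>V\<close> drops the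
  oldest letter. For \<open>r = 1\<close> there is only the vertex 0.\<close>

fun walk :: "nat \<Rightarrow> nat list \<Rightarrow> nat" where
  "walk u [] = u"
| "walk u (x # xs) = walk ((k * u + x) mod V) xs"

fun weight :: "nat \<Rightarrow> nat \<Rightarrow> (nat \<times> nat) list \<Rightarrow> complex" where
  "weight u v [] = 1"
| "weight u v ((a, b) # ps) =
     gram (k * u + a) (k * v + b) * weight ((k * u + a) mod V) ((k * v + b) mod V) ps"

lemma walk_append: "walk u (xs @ ys) = walk (walk u xs) ys"
  by (induction xs arbitrary: u) auto

lemma weight_append:
  "weight u v (ps @ qs) = weight u v ps * weight (walk u (map fst ps)) (walk v (map snd ps)) qs"
  by (induction u v ps rule: weight.induct) auto

abbreviation vertex :: "(int \<Rightarrow> nat) \<Rightarrow> int \<Rightarrow> nat" where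
  "vertex c i \<equiv> window c i (r - 1)"

lemma window_step:
  assumes "\<And>i. c i < k"
  shows "window c i r = k * vertex c (i - 1) + c i" "window c i r mod V = vertex c i"
    "window c i r div k = vertex c (i - 1)"
proof -
  have r: "r = Suc (r - 1)" using r_pos by simp
  show *: "window c i r = k * vertex c (i - 1) + c i"
    by (subst r) simp
  show "window c i r mod V = vertex c i"
    unfolding V_def by (subst (1) r) (rule window_mod[OF assms])
  show "window c i r div k = vertex c (i - 1)"
    unfolding * using assms[of i] by simp
qed

lemma vertex_less: "(\<And>i. c i < k) \<Longrightarrow> vertex c i < V"
  unfolding V_def by (rule window_less)

lemma weight_of_configs:
  assumes "\<And>i. c i < k" "\<And>i. c' i < k"
  shows "weight (vertex c (L - 1)) (vertex c' (L - 1)) (map (\<lambda>j. (c (L + int j), c' (L + int j))) [0..<n])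
    = (\<Prod>j<n. gram (window c (L + int j) r) (window c' (L + int j) r))"
proof (induction n arbitrary: L)
  case (Suc n)
  have m: "map (\<lambda>j. (c (L + int j), c' (L + int j))) [0..<Suc n]
     = (c L, c' L) # map (\<lambda>j. (c ((L + 1) + int j), c' ((L + 1) + int j))) [0..<n]"
    by (subst map_upt_Suc) (simp add: algebra_simps)
  have "(\<Prod>j<Suc n. gram (window c (L + int j) r) (window c' (L + int j) r))
    = gram (window c L r) (window c' L r) *
      (\<Prod>j<n. gram (window c ((L + 1) + int j) r) (window c' ((L + 1) + int j) r))"
    by (subst prod.lessThan_Suc_shift) (simp add: algebra_simps)
  also have "\<dots> = gram (window c L r) (window c' L r) *
     weight (vertex c L) (vertex c' L) (map (\<lambda>j. (c ((L + 1) + int j), c' ((L + 1) + int j))) [0..<n])"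
    using Suc[of "L + 1"] by simp
  finally show ?case
    unfolding m using window_step(1,2)[where c = c and i = L] window_step(1,2)[where c = c' and i = L] assms
    by (simp del: prod.lessThan_Suc)
qed simp

text \<open>Windows are indexed by their last cell, which removes the offset \<open>a\<close>. A
  window ending before \<open>L\<close> is quiescent, and so is one ending at \<open>L + n\<close>
  or later; the \<open>r - 1\<close> windows just after the support still overlap it.\<close>

lemma config_inner_product:
  assumes "is_config k q c" "is_config k q c'"
    and "\<And>i. i \<notin> {L..<L + int M} \<Longrightarrow> c i = q \<and> c' i = q" and "M + (r - 1) \<le> n"
  shows "((\<lambda>d. U a r \<delta> d c * cnj (U a r \<delta> d c')) has_sum
     (\<Prod>j<n. gram (window c (L + int j) r) (window c' (L + int j) r))) {d. is_config k q d}"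
proof -
  \<comment> \<open>The cell whose neighbourhood ends at \<open>L + j\<close>.\<close>
  let ?s = "\<lambda>j. L + int j - a - int r + 1"
  let ?I = "?s ` {..<n}"
  have ck: "c i < k" "c' i < k" for i using assms(1,2) by (auto simp: is_config_def)
  have nb: "nbh a r b i = digits k r (window b (i + a + int r - 1) r)" if "\<And>i. b i < k" for b i
    using digits_window[of b r "i + a + int r - 1"] that by (simp add: nbh_def algebra_simps)
  have out: "nbh a r b i = replicate r q"
    if i: "i \<notin> ?I" and b: "\<And>i. i \<notin> {L..<L + int M} \<Longrightarrow> b i = q" for b i
  proof -
    have "b (i + a + int j) = q" if "j < r" for j
    proof (rule b)
      show "i + a + int j \<notin> {L..<L + int M}"
      proof
        assume "i + a + int j \<in> {L..<L + int M}"
        then have "i = ?s (nat (i + a + int r - 1 - L))" "nat (i + a + int r - 1 - L) < n"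
          using that assms(4) by auto
        then show False using i by blast
      qed
    qed
    then show ?thesis by (auto simp: nbh_def list_eq_iff_nth_eq)
  qed
  have "(\<Prod>i\<in>?I. inner_word (nbh a r c i) (nbh a r c' i))
     = (\<Prod>j<n. gram (window c (L + int j) r) (window c' (L + int j) r))"
    by (subst prod.reindex) (auto simp: inj_on_def nb[OF ck(1)] nb[OF ck(2)] gram_def)
  then show ?thesis
    using column_inner_product[of ?I a c c'] out[of _ c] out[of _ c'] assms(3) by auto
qed


lemma window_cong:
  "(\<And>j. j < l \<Longrightarrow> c (i - int j) = c' (i' - int j)) \<Longrightarrow> window c i l = window c' i' l"
proof (induction l arbitrary: i i')
  case (Suc l)
  have "c (i - 1 - int j) = c' (i' - 1 - int j)" if "j < l" for j
    using Suc.prems[of "Suc j"] that by (simp add: algebra_simps)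
  then show ?case using Suc.IH[of "i - 1" "i' - 1"] Suc.prems[of 0] by simp
qed simp

lemma window_eqD:
  assumes "window c i l = window c' i l" "j < l" "\<And>i. c i < k" "\<And>i. c' i < k"
  shows "c (i - int j) = c' (i - int j)"
  using assms(1,2)
proof (induction l arbitrary: i j)
  case (Suc l)
  have "c i = (k * window c (i - 1) l + c i) mod k" using assms(3) by simp
  also have "\<dots> = (k * window c' (i - 1) l + c' i) mod k" using Suc.prems by simp
  also have "\<dots> = c' i" using assms(4) by simp
  finally have 0: "c i = c' i" .
  with Suc.prems k_pos have "window c (i - 1) l = window c' (i - 1) l" by simp
  with Suc.IH[of "i - 1" "j - 1"] 0 Suc.prems(2) show ?case
    by (cases j) (auto simp: algebra_simps)
qed simp

lemma length_digits: "length (digits k l m) = l"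
  by (induction l arbitrary: m) auto

lemma set_digits: "set (digits k l m) \<subseteq> {..<k}"
  using k_pos by (induction l arbitrary: m) auto

lemma gram_self_nonzero: "gram e e \<noteq> 0"
proof -
  let ?w = "digits k r e"
  obtain x where x: "x < k" "\<delta> ?w x \<noteq> 0"
    using delta_nonzero[OF length_digits set_digits] by blast
  have "gram e e = of_real (\<Sum>x<k. (cmod (\<delta> ?w x))\<^sup>2)"
    by (simp only: gram_def inner_word_def complex_norm_square of_real_sum)
  moreover have "0 < (\<Sum>x<k. (cmod (\<delta> ?w x))\<^sup>2)"
    by (rule sum_pos2[of _ x]) (use x in auto)
  ultimately show ?thesis by (metis less_irrefl of_real_eq_0_iff)
qed

inductive reachable :: "nat \<Rightarrow> nat \<Rightarrow> bool" where
  diagonal: "u < V \<Longrightarrow> reachable u u"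
| step: "reachable u v \<Longrightarrow> x < k \<Longrightarrow> y < k \<Longrightarrow> gram (k * u + x) (k * v + y) \<noteq> 0 \<Longrightarrow>
    reachable ((k * u + x) mod V) ((k * v + y) mod V)"

lemma reachable_less: "reachable u v \<Longrightarrow> u < V \<and> v < V"
  by (induction rule: reachable.induct) (auto simp: V_pos)

end

text \<open>On a de Bruijn graph the edges \<open>0 < v < V\<close> form a spanning tree with root \<open>0\<close>: the edge
  \<open>v\<close> leads from \<open>v div k\<close> to \<open>v\<close>.\<close>
function potential :: "nat \<Rightarrow> (nat \<Rightarrow> complex) \<Rightarrow> nat \<Rightarrow> complex" where
  "potential k W v = (if v = 0 \<or> k < 2 then 1 else potential k W (v div k) * W v)"
  by auto
termination by (relation "Wellfounded.measure (\<lambda>(k, W, v). v)") auto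

declare potential.simps [simp del]

section \<open>The two graph conditions and their sufficiency\<close>

context lqca
begin

abbreviation pot :: "nat \<Rightarrow> complex" where
  "pot \<equiv> potential k (\<lambda>e. gram e e)"

text \<open>Says that each edge weight is the quotient of \<open>pot\<close> at the two ends of the
  edge, so that the weight of a closed walk telescopes to 1.\<close>

definition unit_cycles :: bool where
  "unit_cycles \<longleftrightarrow> (\<forall>e<k * V. gram e e * pot (e div k) = pot (e mod V))"

definition no_merging :: bool where
  "no_merging \<longleftrightarrow> (\<forall>u v x y. reachable u v \<longrightarrow> x < k \<longrightarrow> y < k \<longrightarrow>
     gram (k * u + x) (k * v + y) \<noteq> 0 \<longrightarrow> (k * u + x) mod V = (k * v + y) mod V \<longrightarrow>
     k * u + x = k * v + y)"

lemma pot_nonzero: "pot v \<noteq> 0"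
proof (induction v rule: less_induct)
  case (less v)
  then show ?case
    using two_states by (subst potential.simps) (auto simp: gram_self_nonzero)
qed

lemma telescope:
  assumes "unit_cycles" "\<And>i. c i < k"
  shows "(\<Prod>j<n. gram (window c (L + int j) r) (window c (L + int j) r)) * pot (vertex c (L - 1))
    = pot (vertex c (L + int n - 1))"
proof (induction n)
  case (Suc n)
  let ?e = "window c (L + int n) r"
  have "?e < k * V" using window_less[OF assms(2)] by (simp add: k_V)
  then have "gram ?e ?e * pot (?e div k) = pot (?e mod V)"
    using assms(1) unfolding unit_cycles_def by blast
  then have "gram ?e ?e * pot (vertex c (L + int n - 1)) = pot (vertex c (L + int n))"
    by (simp only: window_step(2,3)[OF assms(2)])
  moreover have "(\<Prod>j<Suc n. gram (window c (L + int j) r) (window c (L + int j) r)) * pot (vertex c (L - 1))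
    = gram ?e ?e * ((\<Prod>j<n. gram (window c (L + int j) r) (window c (L + int j) r)) * pot (vertex c (L - 1)))"
    by (simp add: mult_ac)
  ultimately show ?case by (simp only: Suc) simp
qed simp

text \<open>For equal configurations the product telescopes between two quiescent vertices. For
  distinct ones a nonzero product would make all vertex pairs along the way reachable, and the last
  difference leaving the window would be a merge of distinct edges.\<close>

lemma well_formedI:
  assumes "unit_cycles" "no_merging"
  shows "well_formed k q a r \<delta>"
  unfolding well_formed_def
proof (intro allI impI)
  fix c c' assume cc: "is_config k q c \<and> is_config k q c'"
  then have ck: "c i < k" "c' i < k" for i by (auto simp: is_config_def)
  let ?S = "{i. c i \<noteq> q} \<union> {i. c' i \<noteq> q}"
  have "finite ((\<lambda>i. nat \<bar>i\<bar>) ` ?S)" using cc by (auto simp: is_config_def)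
  then obtain B where B: "\<And>i. i \<in> ?S \<Longrightarrow> nat \<bar>i\<bar> < B"
    using finite_nat_set_iff_bounded by (meson imageI)
  define L where "L = - int B"
  define M where "M = 2 * B"
  define n where "n = M + r"
  have out: "c i = q" "c' i = q" if "i \<notin> {L..<L + int M}" for i
  proof -
    have "i \<notin> ?S"
    proof
      assume "i \<in> ?S"
      then have "nat \<bar>i\<bar> < B" by (rule B)
      then show False using that by (simp add: L_def M_def) linarith
    qed
    then show "c i = q" "c' i = q" by auto
  qed
  let ?P = "\<Prod>j<n. gram (window c (L + int j) r) (window c' (L + int j) r)"
  have sum: "((\<lambda>d. U a r \<delta> d c * cnj (U a r \<delta> d c')) has_sum ?P) {d. is_config k q d}"
    using cc out by (intro config_inner_product[of c c' L M]) (auto simp: n_def)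
  have "?P = (if c = c' then 1 else 0)"
  proof (cases "c = c'")
    case True
    have "vertex c (L - 1) = vertex c (L + int n - 1)"
      by (rule window_cong) (simp add: out(1) n_def)
    then show ?thesis using telescope[OF assms(1), where c = c and n = n and L = L] ck True pot_nonzero by simp
  next
    case False
    show ?thesis
    proof (rule ccontr)
      assume "?P \<noteq> (if c = c' then 1 else 0)"
      then have nz: "gram (window c (L + int j) r) (window c' (L + int j) r) \<noteq> 0" if "j < n" for j
        using False that by auto
      have r: "reachable (vertex c (L + int j - 1)) (vertex c' (L + int j - 1))" if "j \<le> n" for j
        using that
      proof (induction j)
        case 0
        have "vertex c (L - 1) = vertex c' (L - 1)"
          by (rule window_cong) (simp add: out)
        then show ?case using diagonal[OF vertex_less[of c']] ck by simp
      next
        case (Suc j)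
        then have "gram (k * vertex c (L + int j - 1) + c (L + int j)) (k * vertex c' (L + int j - 1) + c' (L + int j)) \<noteq> 0"
          using nz[of j] window_step(1)[where c = c and i = "L + int j"]
            window_step(1)[where c = c' and i = "L + int j"] ck by simp
        from reachable.step[OF _ ck this] Suc show ?case
          using window_step(1,2)[where c = c and i = "L + int j"]
            window_step(1,2)[where c = c' and i = "L + int j"] ck by (simp add: algebra_simps)
      qed
      \<comment> \<open>The rightmost difference. Its cell is the last one at which the two walks
        can still be told apart.\<close>
      define i0 where "i0 = Max {i. c i \<noteq> c' i}"
      have D: "{i. c i \<noteq> c' i} \<subseteq> ?S" by auto
      have fin: "finite {i. c i \<noteq> c' i}"
        by (rule finite_subset[OF D]) (use cc in \<open>auto simp: is_config_def\<close>)
      have "{i. c i \<noteq> c' i} \<noteq> {}" using False by auto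
      then have i0: "c i0 \<noteq> c' i0" using Max_in[OF fin] by (simp add: i0_def)
      have after: "c i = c' i" if "i0 < i" for i
        using Max_ge[OF fin, of i] that by (auto simp: i0_def)
      have "i0 \<in> {L..<L + int M}" using out i0 by metis
      \<comment> \<open>The window ending \<open>r - 1\<close> cells after \<open>i0\<close> has
        \<open>i0\<close> as its oldest cell: the two edges differ there, but their targets, which
        have lost this cell, coincide.\<close>
      then obtain j where j: "L + int j = i0 + int r - 1" "j < n"
        using r_pos by (intro that[of "nat (i0 + int r - 1 - L)"]) (auto simp: n_def)
      let ?e = "window c (L + int j) r" and ?e' = "window c' (L + int j) r"
      have "vertex c (L + int j) = vertex c' (L + int j)"
        by (rule window_cong) (use j(1) in \<open>auto intro: after\<close>)
      moreover have "?e \<noteq> ?e'"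
        using window_eqD[of c "L + int j" r c' "r - 1"] i0 j(1) r_pos ck by auto
      ultimately show False
        using assms(2) r[of j] nz[OF j(2)] j(2) ck
          window_step(1,2)[where c = c and i = "L + int j"]
          window_step(1,2)[where c = c' and i = "L + int j"]
        unfolding no_merging_def by (metis less_imp_le)
    qed
  qed
  then show "((\<lambda>d. U a r \<delta> d c * cnj (U a r \<delta> d c')) has_sum (if c = c' then 1 else 0)) {d. is_config k q d}"
    using sum by simp
qed


section \<open>Necessity of the two graph conditions\<close>

definition Q :: nat where "Q = window (\<lambda>_. q) 0 (r - 1)"

text \<open>These letters stand for the \<open>r - 1\<close> cells behind the support; they bring
  every vertex back to the quiescent one.\<close>

abbreviation sync :: "(nat \<times> nat) list" where "sync \<equiv> replicate (r - 1) (q, q)"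

lemma Q_less: "Q < V"
  unfolding Q_def V_def by (rule window_less) (rule q_less)

lemma walk_digits:
  assumes "u < V" "v < k ^ l"
  shows "walk u (digits k l v) = (u * k ^ l + v) mod V"
  using assms(2)
proof (induction l arbitrary: v)
  case (Suc l)
  have d: "v div k < k ^ l" using Suc.prems k_pos by (simp add: div_less_iff_less_mult mult.commute)
  have "walk u (digits k (Suc l) v) = (k * ((u * k ^ l + v div k) mod V) + v mod k) mod V"
    using Suc.IH[OF d] by (simp add: walk_append)
  also have "\<dots> = (k * (u * k ^ l + v div k) + v mod k) mod V"
    by (metis mod_add_left_eq mod_mult_right_eq)
  also have "k * (u * k ^ l + v div k) + v mod k = u * k ^ Suc l + v"
    by (simp add: algebra_simps)
  finally show ?case .
qed (use assms in simp)

text \<open>A word of \<open>r - 1\<close> letters overwrites the whole vertex: the starting point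
  \<open>u\<close> enters with the factor \<open>k ^ (r - 1) = V\<close> and vanishes modulo
  \<open>V\<close>. Hence every vertex is reached from every other.\<close>

lemma walk_to: "u < V \<Longrightarrow> v < V \<Longrightarrow> walk u (digits k (r - 1) v) = v"
  using walk_digits[of u v "r - 1"] by (simp add: V_def)

text \<open>A list of letter pairs is written into two configurations from cell 0 on, with quiescent
  cells elsewhere. The weight of the closed walk pair is then the inner product of the two columns,
  which well-formedness prescribes.\<close>

lemma well_formed_weight:
  assumes wf: "well_formed k q a r \<delta>" and ps: "set ps \<subseteq> {..<k} \<times> {..<k}"
  shows "weight Q Q (ps @ sync) = (if map fst ps = map snd ps then 1 else 0)"
proof -
  define conf where "conf = (\<lambda>xs (i::int). if 0 \<le> i \<and> i < int (length xs) then xs ! nat i else q)"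
  define c c' where "c = conf (map fst ps)" and "c' = conf (map snd ps)"
  have fst_snd: "fst (ps ! j) < k" "snd (ps ! j) < k" if "j < length ps" for j
    using subsetD[OF ps nth_mem[OF that]] by (auto simp: mem_Times_iff)
  have ck: "c i < k" "c' i < k" for i
    using fst_snd[of "nat i"] q_less by (auto simp: c_def c'_def conf_def)
  have out: "c i = q \<and> c' i = q" if "i \<notin> {0..<int (length ps)}" for i
    using that by (auto simp: c_def c'_def conf_def)
  have "{i. c i \<noteq> q} \<subseteq> {0..<int (length ps)}" "{i. c' i \<noteq> q} \<subseteq> {0..<int (length ps)}"
    using out by blast+
  then have "finite {i. c i \<noteq> q}" "finite {i. c' i \<noteq> q}"
    by (auto intro: finite_subset)
  then have cc: "is_config k q c" "is_config k q c'" using ck by (auto simp: is_config_def)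
  have eq: "c = c' \<longleftrightarrow> map fst ps = map snd ps"
  proof
    assume "c = c'"
    then have "fst (ps ! j) = snd (ps ! j)" if "j < length ps" for j
      using fun_cong[OF \<open>c = c'\<close>, of "int j"] that unfolding c_def c'_def conf_def by simp
    then show "map fst ps = map snd ps" by (simp add: list_eq_iff_nth_eq)
  qed (simp only: c_def c'_def)
  let ?n = "length ps + (r - 1)"
  have m: "map (\<lambda>j. (c (0 + int j), c' (0 + int j))) [0..<?n] = ps @ sync"
    by (rule nth_equalityI) (auto simp: c_def c'_def conf_def nth_append)
  have v: "vertex c (0 - 1) = Q" "vertex c' (0 - 1) = Q"
    unfolding Q_def by (rule window_cong; simp add: out)+
  have "((\<lambda>d. U a r \<delta> d c * cnj (U a r \<delta> d c')) has_sum weight Q Q (ps @ sync)) {d. is_config k q d}"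
    unfolding weight_of_configs[where c = c and c' = c' and L = 0 and n = ?n, OF ck, unfolded m v]
    by (rule config_inner_product[OF cc, where M = "length ps"]) (use out in auto)
  moreover have "((\<lambda>d. U a r \<delta> d c * cnj (U a r \<delta> d c')) has_sum (if c = c' then 1 else 0)) {d. is_config k q d}"
    using wf cc unfolding well_formed_def by blast
  ultimately have "weight Q Q (ps @ sync) = (if c = c' then 1 else 0)"
    by (rule has_sum_unique)
  then show ?thesis unfolding eq .
qed

lemma well_formedD:
  assumes wf: "well_formed k q a r \<delta>"
  shows "unit_cycles" "no_merging"
proof -
  define dup where "dup = map (\<lambda>x::nat. (x, x))"
  have fs: "map fst (dup xs) = xs" "map snd (dup xs) = xs" for xs
    by (auto simp: dup_def o_def)
  \<comment> \<open>\<open>\<alpha> v\<close> is the weight of a standard diagonal walk from the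
    quiescent vertex to \<open>v\<close>, and \<open>\<beta> v\<close> that of the way back.\<close>
  define \<alpha> where "\<alpha> v = weight Q Q (dup (digits k (r - 1) v))" for v
  define \<beta> where "\<beta> v = weight v v sync" for v
  have dupk: "set (dup (digits k l v)) \<subseteq> {..<k} \<times> {..<k}" for l v
    using set_digits[of l v] by (auto simp: dup_def)
  have \<alpha>\<beta>: "\<alpha> v * \<beta> v = 1" if "v < V" for v
    using well_formed_weight[OF wf dupk[of "r - 1" v]] that
    by (simp add: weight_append fs walk_to[OF Q_less, simplified] \<alpha>_def \<beta>_def)
  \<comment> \<open>Inserting the edge \<open>e\<close> before the return gives another closed walk
    of weight 1. Comparing it with the standard one through \<open>e mod V\<close> and cancelling
    \<open>\<beta>\<close> shows that \<open>\<alpha>\<close> is a potential.\<close>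
  have edge: "gram e e * \<alpha> (e div k) = \<alpha> (e mod V)" if "e < k * V" for e
  proof -
    let ?u = "e div k" and ?x = "e mod k"
    have u: "?u < V" using that k_pos by (simp add: div_less_iff_less_mult mult.commute)
    have e: "k * ?u + ?x = e" by simp
    have "set (dup (digits k (r - 1) ?u) @ [(?x, ?x)]) \<subseteq> {..<k} \<times> {..<k}"
      using dupk[of "r - 1" ?u] k_pos by auto
    from well_formed_weight[OF wf this] have "\<alpha> ?u * (gram e e * \<beta> (e mod V)) = 1"
      using u by (simp add: weight_append fs walk_to[OF Q_less, simplified] \<alpha>_def \<beta>_def e)
    moreover have "\<alpha> (e mod V) * \<beta> (e mod V) = 1" using \<alpha>\<beta> V_pos by simp
    ultimately have "\<beta> (e mod V) \<noteq> 0" "gram e e * \<alpha> ?u * \<beta> (e mod V) = \<alpha> (e mod V) * \<beta> (e mod V)"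
      by (auto simp: mult_ac)
    then show ?thesis by simp
  qed
  \<comment> \<open>Along the spanning tree \<open>pot\<close> obeys the same recursion as
    \<open>\<alpha>\<close>, so the two differ by the value at the root only.\<close>
  have pot: "pot v * \<alpha> 0 = \<alpha> v" if "v < V" for v
    using that
  proof (induction v rule: less_induct)
    case (less v)
    show ?case
    proof (cases "v = 0")
      case True
      then show ?thesis by (simp add: potential.simps)
    next
      case False
      have d: "v div k < v" using False two_states by simp
      have "1 * V \<le> k * V" by (rule mult_le_mono1) (use two_states in simp)
      then have "v < k * V" using less.prems by linarith
      have "pot v * \<alpha> 0 = gram v v * (pot (v div k) * \<alpha> 0)"
        using False two_states by (subst potential.simps) (simp add: mult_ac)
      also have "\<dots> = gram v v * \<alpha> (v div k)" using less.IH[OF d] less.prems d by simp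
      also have "\<dots> = \<alpha> v" using edge[OF \<open>v < k * V\<close>] less.prems by simp
      finally show ?thesis .
    qed
  qed
  have \<alpha>0: "\<alpha> 0 \<noteq> 0" using \<alpha>\<beta>[OF V_pos] by auto
  show "unit_cycles"
    unfolding unit_cycles_def
  proof (intro allI impI)
    fix e assume e: "e < k * V"
    have u: "e div k < V" using e k_pos by (simp add: div_less_iff_less_mult mult.commute)
    have "gram e e * pot (e div k) * \<alpha> 0 = pot (e mod V) * \<alpha> 0"
      using edge[OF e] pot[OF u] pot[of "e mod V"] V_pos by (simp add: mult.assoc)
    then show "gram e e * pot (e div k) = pot (e mod V)" using \<alpha>0 by simp
  qed
  \<comment> \<open>The search starts on the whole diagonal, configurations start at
    \<open>Q\<close>. The standard walk to \<open>u\<close> closes this gap, because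
    \<open>\<alpha> u\<close> is nonzero.\<close>
  have path: "\<exists>ps. set ps \<subseteq> {..<k} \<times> {..<k} \<and> weight Q Q ps \<noteq> 0 \<and>
      walk Q (map fst ps) = u \<and> walk Q (map snd ps) = v" if "reachable u v" for u v
    using that
  proof (induction rule: reachable.induct)
    case (diagonal u)
    have "\<alpha> u \<noteq> 0" using \<alpha>\<beta>[OF diagonal] by auto
    then show ?case
      by (intro exI[of _ "dup (digits k (r - 1) u)"])
        (use dupk in \<open>simp add: \<alpha>_def fs walk_to[OF Q_less diagonal, simplified]\<close>)
  next
    case (step u v x y)
    then obtain ps where "set ps \<subseteq> {..<k} \<times> {..<k}" "weight Q Q ps \<noteq> 0"
      "walk Q (map fst ps) = u" "walk Q (map snd ps) = v" by blast
    then show ?case using step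
      by (intro exI[of _ "ps @ [(x, y)]"]) (auto simp: weight_append walk_append)
  qed
  show "no_merging"
    unfolding no_merging_def
  proof (intro allI impI, rule ccontr)
    fix u v x y
    assume *: "reachable u v" "x < k" "y < k" "gram (k * u + x) (k * v + y) \<noteq> 0"
      "(k * u + x) mod V = (k * v + y) mod V" "k * u + x \<noteq> k * v + y"
    obtain ps where ps: "set ps \<subseteq> {..<k} \<times> {..<k}" "weight Q Q ps \<noteq> 0"
      "walk Q (map fst ps) = u" "walk Q (map snd ps) = v" using path[OF *(1)] by blast
    let ?ps = "ps @ [(x, y)]"
    let ?t = "(k * v + y) mod V"
    \<comment> \<open>After the merge both walks return together along the diagonal with this
      nonzero weight. The outcome would be two distinct columns that are not orthogonal.\<close>
    have "\<beta> ?t \<noteq> 0" using \<alpha>\<beta>[of ?t] V_pos by auto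
    then have "weight Q Q (?ps @ sync) \<noteq> 0"
      using ps * by (simp add: weight_append \<beta>_def)
    \<comment> \<open>Equal letter sequences read from \<open>Q\<close> would give
      \<open>u = v\<close> and \<open>x = y\<close>.\<close>
    moreover have "map fst ?ps \<noteq> map snd ?ps" using ps(3,4) *(6) by (metis map_append append1_eq_conv list.simps(8,9) fst_conv snd_conv)
    moreover have "set ?ps \<subseteq> {..<k} \<times> {..<k}" using ps(1) *(2,3) by auto
    ultimately show False using well_formed_weight[OF wf, of ?ps] by (simp only: if_False)
  qed
qed

theorem well_formed_iff: "well_formed k q a r \<delta> \<longleftrightarrow> unit_cycles \<and> no_merging"
  using well_formedI well_formedD by blast

end

section \<open>The decision procedure\<close>

text \<open>Memory layout, with \<open>n = k ^ (r + 1)\<close>. Registers: 3, 4, 5, 6, 10 hold \<open>V = k ^ (r - 1)\<close>,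
  \<open>k * V\<close>, \<open>n\<close>, \<open>2 * n\<close>, \<open>V * V\<close>; 7 holds 1; 8 is set to 1 once a violation is found; 9 is the
  length of the queue. For an edge \<open>e\<close> the arrays 0 to 3 hold \<open>e mod V\<close>, \<open>V * (e mod V)\<close>,
  \<open>e div k\<close> and the address of the row \<open>e\<close> of the table; arrays 4 and 5 hold the queue of vertex
  pairs and array 6 marks its members. The table is first copied to the cells from \<open>n\<close> on, which
  frees the complex cells 0 to 3; the potential is stored from \<open>2 * n\<close> on.\<close>

definition agree :: "'a set \<Rightarrow> ('a \<Rightarrow> 'b) \<Rightarrow> ('a \<Rightarrow> 'b) \<Rightarrow> bool" where
  "agree X f g \<longleftrightarrow> (\<forall>i. i \<notin> X \<longrightarrow> f i = g i)"

lemma agreeD: "agree X f g \<Longrightarrow> i \<notin> X \<Longrightarrow> f i = g i"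
  by (simp add: agree_def)

lemma agree_refl [simp]: "agree X f f"
  by (simp add: agree_def)

lemma agree_upd [simp]: "i \<in> X \<Longrightarrow> agree X (f(i := y)) g \<longleftrightarrow> agree X f g"
  by (auto simp: agree_def)

lemma agree_if [simp]: "i \<in> X \<Longrightarrow> agree X (\<lambda>a. if a = i then y else f a) g \<longleftrightarrow> agree X f g"
  by (auto simp: agree_def)

lemma wp_Prim_Seq:
  "prim_ok i \<Longrightarrow> 1 \<le> T \<Longrightarrow> wp b (T - 1) (prim_c i C R) (prim_n i R) A Q \<Longrightarrow> wp (Prim i ;; b) T C R A Q"
  by (intro wp_Seq wp_Prim)

lemma wp_ALoad_Seq:
  "d < 29 \<Longrightarrow> j < 8 \<Longrightarrow> x < 29 \<Longrightarrow> 6 \<le> T \<Longrightarrow> wp b (T - 6) C (R(d := A j (R x))) A Q \<Longrightarrow>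
    wp (ALoad d j x ;; b) T C R A Q"
  by (intro wp_Seq wp_ALoad)

lemma wp_Call_Seq:
  assumes "wp c T1 C R A (\<lambda>_. Q')" "T1 \<le> T"
    and "\<And>T' C R A. T - T1 \<le> T' \<Longrightarrow> Q' C R A \<Longrightarrow> wp b T' C R A Q"
  shows "wp (c ;; b) T C R A Q"
  by (intro wp_Seq wp_conseq[OF assms])

section \<open>Multiplication of index registers and inner products of table rows\<close>

definition mul :: "nat \<Rightarrow> nat \<Rightarrow> nat \<Rightarrow> nat \<Rightarrow> com" where
  "mul i d x y = (Prim (NConst d 0) ;; For i y (Prim (NAdd d d x)))"

text \<open>Repeated addition: the cost is linear in the factor held in \<open>y\<close>, for which
  the program uses only \<open>k\<close> and \<open>V\<close>.\<close>

lemma wp_mul: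
  assumes "i < 29" "d < 29" "x < 29" "y < 29" "distinct [i, d, x, y]"
  shows "wp (mul i d x y) (5 * R y + 3) C R A
    (\<lambda>_ C' R' A'. C' = C \<and> A' = A \<and> R' d = R x * R y \<and> agree {i, d} R' R)"
proof -
  let ?Inv = "\<lambda>j C' R' A'. C' = C \<and> A' = A \<and> R' d = R x * j \<and> agree {i, d} R' R"
  have "wp (For i y (Prim (NAdd d d x))) ((1 + 4) * (R(d := 0)) y + 2) C (R(d := 0)) A (\<lambda>_. ?Inv ((R(d := 0)) y))"
  proof (rule wp_For)
    fix j C' R' A'
    assume j: "j < (R(d := 0)) y" "?Inv j C' R' A'" "R' i = j" "R' y = (R(d := 0)) y"
    then have "R' x = R x" using assms(5) by (auto intro: agreeD)
    then show "wp (Prim (NAdd d d x)) 1 C' R' A'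
      (\<lambda>_ C'' R'' A''. R'' i = j \<and> R'' y = (R(d := 0)) y \<and> ?Inv (Suc j) C'' (R''(i := Suc j)) A'')"
      using assms j by (intro vc_wp) (auto simp: fun_upd_twist)
  qed (use assms in auto)
  then show ?thesis
    unfolding mul_def using assms
    by (intro wp_Seq vc_wp[of "Prim _"]) (auto elim: wp_conseq)
qed

text \<open>Registers 20 and 21 enter with the addresses of the two rows and advance by register 7,
  which holds 1. The result is left in complex cell 1.\<close>

definition gram_code :: com where
  "gram_code = (Prim (CConst 1 0) ;;
     For 27 0 (Prim (CLoad 2 20) ;; Prim (CLoad 3 21) ;; Prim (CConj 3 3) ;; Prim (CMul 2 2 3) ;;
       Prim (CAdd 1 1 2) ;; Prim (NAdd 20 20 7) ;; Prim (NAdd 21 21 7)))"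

context lqca
begin

definition size_in :: nat where "size_in = k * (k * V)"

definition table :: "nat \<Rightarrow> complex" where
  "table m = (let ds = digits k (r + 1) m in \<delta> (butlast ds) (last ds))"

text \<open>The output state is the last base-\<open>k\<close> digit of a table index, so the vector
  assigned to the window \<open>e\<close> occupies the \<open>k\<close> consecutive cells from
  \<open>k * e\<close> on.\<close>

lemma gram_table: "gram e e' = (\<Sum>x<k. table (k * e + x) * cnj (table (k * e' + x)))"
  unfolding gram_def inner_word_def table_def
  by (rule sum.cong) (auto simp: Let_def)

text \<open>The bound 4 keeps the complex scratch cells 0 to 3 below the copy of the table, which
  starts at \<open>size_in\<close>.\<close>

lemma size_in_ge: "4 \<le> size_in" "V \<le> k * V" "k * V \<le> size_in"
proof -
  show "V \<le> k * V" "k * V \<le> size_in" using k_pos by (simp_all add: size_in_def)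
  have "2 * (2 * 1) \<le> k * (k * V)" using two_states V_pos by (intro mult_le_mono) auto
  then show "4 \<le> size_in" by (simp add: size_in_def)
qed

definition has_table :: "cmem \<Rightarrow> bool" where
  "has_table C \<longleftrightarrow> (\<forall>m<size_in. C (size_in + m) = table m)"

lemma wp_gram_code:
  assumes "R 0 = k" "R 7 = 1" "R 20 = size_in + k * e" "R 21 = size_in + k * e'"
    "e < k * V" "e' < k * V" "has_table C"
  shows "wp gram_code (11 * k + 3) C R A
    (\<lambda>_ C' R' A'. C' 1 = gram e e' \<and> A' = A \<and> agree {1, 2, 3} C' C \<and> agree {20, 21, 27} R' R)"
proof -
  let ?Inv = "\<lambda>j C' R' A'. C' 1 = (\<Sum>x<j. table (k * e + x) * cnj (table (k * e' + x))) \<and> A' = A \<and>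
    agree {1, 2, 3} C' C \<and> agree {20, 21, 27} R' R \<and> R' 20 = size_in + k * e + j \<and> R' 21 = size_in + k * e' + j"
  let ?b = "Prim (CLoad 2 20) ;; Prim (CLoad 3 21) ;; Prim (CConj 3 3) ;; Prim (CMul 2 2 3) ;;
       Prim (CAdd 1 1 2) ;; Prim (NAdd 20 20 7) ;; Prim (NAdd 21 21 7)"
  have "wp (For 27 0 ?b) ((7 + 4) * R 0 + 2) (C(1 := 0)) R A (\<lambda>_. ?Inv (R 0))"
  proof (rule wp_For)
    fix j C' R' A'
    assume j: "j < R 0" "?Inv j C' R' A'" "R' 27 = j" "R' 0 = R 0"
    have lt: "k * f + j < size_in" if "f < k * V" for f
    proof -
      have "k * f + j < k * (f + 1)" using j(1) assms(1) by simp
      also have "\<dots> \<le> size_in" unfolding size_in_def using that by (intro mult_le_mono2) simp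
      finally show ?thesis .
    qed
    have "C (size_in + k * f + j) = table (k * f + j)" "size_in + k * f + j \<notin> {1, 2, 3}" if "f < k * V" for f
      using lt[OF that] assms(7) size_in_ge(1) by (auto simp: has_table_def add.assoc)
    then have "C' (size_in + k * f + j) = table (k * f + j)" "size_in + k * f + j \<noteq> 2" if "f < k * V" for f
      using j(2) that by (auto simp: agree_def)
    moreover have "R' 7 = 1" using j(2) assms(2) by (simp add: agree_def)
    ultimately show "wp ?b 7 C' R' A'
       (\<lambda>_ C'' R'' A''. R'' 27 = j \<and> R'' 0 = R 0 \<and> ?Inv (Suc j) C'' (R''(27 := Suc j)) A'')"
      using assms(5,6) j by (intro vc_wp) simp
  qed (use assms in auto)
  then show ?thesis
    unfolding gram_code_def gram_table
    by (intro wp_Seq vc_wp[of "Prim _"]) (auto simp: assms(1) elim!: wp_conseq)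
qed

end

section \<open>Initialisation: powers of \<open>k\<close>, copy of the table, index arrays\<close>

definition power_code :: com where
  "power_code = (Prim (NConst 9 0) ;; Prim (NConst 3 1) ;; Prim (NConst 4 1) ;;
     For 11 1 (Prim (NAdd 3 4 9) ;; mul 13 12 3 0 ;; Prim (NAdd 4 12 9)) ;;
     mul 13 5 4 0 ;; Prim (NAdd 6 5 5) ;; Prim (NAdd 12 3 9) ;; mul 13 10 3 12)"

definition copy_code :: com where
  "copy_code = For 11 5 (Prim (NAdd 12 5 11) ;; Prim (CLoad 0 11) ;; Prim (CStore 0 12))"

text \<open>Residues and quotients come from counters that wrap around at \<open>V\<close> and at
  \<open>k\<close>, in place of division. Register 14 is still 0 at the subtraction, which therefore
  copies the table address into register 16.\<close>

definition index_code :: com where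
  "index_code = (Prim (NConst 12 0) ;; Prim (NConst 13 0) ;; Prim (NConst 14 0) ;; Prim (NConst 15 0) ;;
     Prim (NSub 16 5 14) ;;
     For 11 4 (AStore 0 11 12 ;; AStore 1 11 13 ;; AStore 2 11 14 ;; AStore 3 11 16 ;;
       Prim (NAdd 12 12 7) ;; Prim (NAdd 13 13 3) ;;
       If (TLe 3 12) (Prim (NConst 12 0) ;; Prim (NConst 13 0)) Skip ;;
       Prim (NAdd 15 15 7) ;;
       If (TLe 0 15) (Prim (NConst 15 0) ;; Prim (NAdd 14 14 7)) Skip ;;
       Prim (NAdd 16 16 0)))"

context lqca
begin

text \<open>Register 9 holds 0 here, so adding it copies a register. Each round saves
  \<open>k ^ j\<close> in register 3 before register 4 is multiplied by \<open>k\<close>; after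
  \<open>r\<close> rounds they hold \<open>k ^ (r - 1)\<close> and \<open>k ^ r\<close>. For the
  square of \<open>V\<close> a copy is made because \<open>mul\<close> wants distinct
  registers.\<close>

lemma wp_power_code:
  assumes "R 0 = k" "R 1 = r"
  shows "wp power_code (5 * k * r + 9 * r + 5 * k + 5 * V + 20) C R A
    (\<lambda>_ C' R' A'. C' = C \<and> A' = A \<and> R' 3 = V \<and> R' 4 = k * V \<and> R' 5 = size_in \<and>
       R' 6 = 2 * size_in \<and> R' 10 = V * V \<and> agree {3, 4, 5, 6, 9, 10, 11, 12, 13} R' R)"
proof -
  let ?X = "{3, 4, 9, 11, 12, 13}"
  let ?Inv = "\<lambda>j C' R' A'. C' = C \<and> A' = A \<and> R' 4 = k ^ j \<and> (0 < j \<longrightarrow> R' 3 = k ^ (j - 1)) \<and> R' 9 = 0 \<and>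
    agree ?X R' R"
  let ?b = "Prim (NAdd 3 4 9) ;; mul 13 12 3 0 ;; Prim (NAdd 4 12 9)"
  let ?R = "R(9 := 0, 3 := 1, 4 := 1)"
  have loop: "wp (For 11 1 ?b) ((5 * k + 5 + 4) * ?R 1 + 2) C ?R A (\<lambda>_. ?Inv (?R 1))"
  proof (rule wp_For)
    fix j C' R' A'
    assume j: "j < ?R 1" "?Inv j C' R' A'" "R' 11 = j" "R' 1 = ?R 1"
    have k: "R' 0 = k" using j(2) assms by (simp add: agree_def)
    let ?R' = "R'(3 := k ^ j)"
    have m: "wp (mul 13 12 3 0) (5 * ?R' 0 + 3) C ?R' A
      (\<lambda>_ C'' R'' A''. C'' = C \<and> A'' = A \<and> R'' 12 = ?R' 3 * ?R' 0 \<and> agree {13, 12} R'' ?R')"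
      by (rule wp_mul) auto
    show "wp ?b (5 * k + 5) C' R' A'
       (\<lambda>_ C'' R'' A''. R'' 11 = j \<and> R'' 1 = ?R 1 \<and> ?Inv (Suc j) C'' (R''(11 := Suc j)) A'')"
      apply (rule wp_Seq, rule vc_wp)
      apply (simp add: j)
      apply (rule wp_Seq)
      apply (rule wp_conseq[OF m])
       apply (simp add: k)
      apply (rule vc_wp)
      using j k
      apply (auto simp: agree_def)
      done
  qed (use assms in auto)
  have loop': "wp (For 11 1 ?b) (5 * k * r + 9 * r + 2) C ?R A (\<lambda>_ C' R' A'. C' = C \<and> A' = A \<and>
      R' 3 = V \<and> R' 4 = k * V \<and> R' 0 = k \<and> R' 9 = 0 \<and> agree ?X R' R)"
    by (rule wp_conseq[OF loop]) (use r_pos k_V assms in \<open>auto simp: algebra_simps V_def agree_def\<close>)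
  show ?thesis
    unfolding power_code_def
    apply (rule wp_Prim_Seq, simp, simp, simp only: prim_c.simps prim_n.simps)+
    apply (rule wp_Call_Seq[OF loop'], simp)
    apply (rule wp_Call_Seq[OF wp_mul], simp_all)
    apply (elim conjE)
    apply (rule wp_Prim_Seq, simp, simp, simp only: prim_c.simps prim_n.simps)+
    apply (rule wp_conseq[OF wp_mul], simp_all)
    apply (auto simp: agree_def size_in_def)
    done
qed


lemma wp_copy_code:
  assumes "R 5 = size_in" "\<And>m. m < size_in \<Longrightarrow> C m = table m"
  shows "wp copy_code (7 * size_in + 2) C R A
    (\<lambda>_ C' R' A'. has_table C' \<and> A' = A \<and> agree {11, 12} R' R)"
proof -
  \<comment> \<open>Cell 0 is the transfer cell: round 0 copies its own content, and from then on
    the original is lost.\<close>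
  let ?Inv = "\<lambda>j C' R' A'. (\<forall>m<size_in. 0 < m \<or> j = 0 \<longrightarrow> C' m = table m) \<and>
    (\<forall>m<j. C' (size_in + m) = table m) \<and> A' = A \<and> agree {11, 12} R' R"
  let ?b = "Prim (NAdd 12 5 11) ;; Prim (CLoad 0 11) ;; Prim (CStore 0 12)"
  have "wp (For 11 5 ?b) ((3 + 4) * R 5 + 2) C R A (\<lambda>_. ?Inv (R 5))"
  proof (rule wp_For)
    fix j C' R' A'
    assume j: "j < R 5" "?Inv j C' R' A'" "R' 11 = j" "R' 5 = R 5"
    have "C' j = table j" using j(1,2) assms(1) by auto
    then show "wp ?b 3 C' R' A'
       (\<lambda>_ C'' R'' A''. R'' 11 = j \<and> R'' 5 = R 5 \<and> ?Inv (Suc j) C'' (R''(11 := Suc j)) A'')"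
      using j assms(1) size_in_ge(1) by (intro vc_wp) (auto simp: less_Suc_eq)
  qed (use assms in auto)
  then show ?thesis
    unfolding copy_code_def by (rule wp_conseq) (use assms in \<open>auto simp: has_table_def\<close>)
qed

definition index_arrays :: "nat \<Rightarrow> amem \<Rightarrow> bool" where
  "index_arrays n A \<longleftrightarrow> (\<forall>e<n. A 0 e = e mod V \<and> A 1 e = V * (e mod V) \<and> A 2 e = e div k \<and>
     A 3 e = size_in + k * e)"

lemma wp_index_code:
  assumes "R 0 = k" "R 3 = V" "R 4 = k * V" "R 5 = size_in" "R 7 = 1"
  shows "wp index_code (39 * (k * V) + 7) C R A
    (\<lambda>_ C' R' A'. C' = C \<and> index_arrays (k * V) A' \<and> agree {0, 1, 2, 3} A' A \<and>
      agree {11, 12, 13, 14, 15, 16} R' R)"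
proof -
  let ?X = "{11, 12, 13, 14, 15, 16}"
  let ?Inv = "\<lambda>j C' R' A'. C' = C \<and> index_arrays j A' \<and> agree {0, 1, 2, 3} A' A \<and> agree ?X R' R \<and>
    R' 12 = j mod V \<and> R' 13 = V * (j mod V) \<and> R' 14 = j div k \<and> R' 15 = j mod k \<and> R' 16 = size_in + k * j"
  let ?b = "AStore 0 11 12 ;; AStore 1 11 13 ;; AStore 2 11 14 ;; AStore 3 11 16 ;;
       Prim (NAdd 12 12 7) ;; Prim (NAdd 13 13 3) ;;
       If (TLe 3 12) (Prim (NConst 12 0) ;; Prim (NConst 13 0)) Skip ;;
       Prim (NAdd 15 15 7) ;;
       If (TLe 0 15) (Prim (NConst 15 0) ;; Prim (NAdd 14 14 7)) Skip ;;
       Prim (NAdd 16 16 0)"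
  let ?R = "R(12 := 0, 13 := 0, 14 := 0, 15 := 0, 16 := size_in)"
  have loop: "wp (For 11 4 ?b) ((35 + 4) * ?R 4 + 2) C ?R A (\<lambda>_. ?Inv (?R 4))"
  proof (rule wp_For)
    fix j C' R' A'
    assume j: "j < ?R 4" "?Inv j C' R' A'" "R' 11 = j" "R' 4 = ?R 4"
    have e: "R' 0 = k" "R' 3 = V" "R' 7 = 1" using j(2) assms by (auto simp: agree_def)
    have "j mod V < V" "j mod k < k" using V_pos k_pos by auto
    then have m: "V \<le> Suc (j mod V) \<longleftrightarrow> Suc (j mod V) = V" "k \<le> Suc (j mod k) \<longleftrightarrow> Suc (j mod k) = k"
      by linarith+
    show "wp ?b 35 C' R' A'
       (\<lambda>_ C'' R'' A''. R'' 11 = j \<and> R'' 4 = ?R 4 \<and> ?Inv (Suc j) C'' (R''(11 := Suc j)) A'')"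
      using j e m
      by (intro vc_wp)
        (simp add: mod_Suc div_Suc index_arrays_def less_Suc_eq all_conj_distrib imp_conjR)
  qed (use assms in \<open>auto simp: index_arrays_def\<close>)
  show ?thesis
    unfolding index_code_def
    apply (rule wp_Prim_Seq, simp, simp, simp only: prim_c.simps prim_n.simps)+
    apply (simp add: assms del: One_nat_def)
    apply (rule wp_conseq[OF loop])
    using assms apply (auto simp: agree_def)
    done
qed

end

section \<open>Computing the potential and testing the edges\<close>

definition check_code :: com where
  "check_code = (Prim (CLoad 2 18) ;; If (TEq 1 2) Skip (Prim (NConst 8 1)))"

definition potential_body :: com where
  "potential_body = (ALoad 20 3 11 ;; ALoad 21 3 11 ;; gram_code ;;
     ALoad 19 2 11 ;; Prim (NAdd 19 6 19) ;; Prim (CLoad 2 19) ;; Prim (CMul 1 1 2) ;;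
     ALoad 18 0 11 ;; Prim (NAdd 18 6 18) ;;
     If (TLe 7 11) (If (TLe 3 11) check_code (Prim (CStore 1 18))) check_code)"

definition potential_code :: com where
  "potential_code = (Prim (CConst 0 1) ;; Prim (CStore 0 6) ;; For 11 4 potential_body)"

context lqca
begin

definition env :: "nmem \<Rightarrow> bool" where
  "env R \<longleftrightarrow> R 0 = k \<and> R 3 = V \<and> R 4 = k * V \<and> R 5 = size_in \<and> R 6 = 2 * size_in \<and> R 7 = 1 \<and>
     R 10 = V * V"

definition cycle_at :: "nat \<Rightarrow> bool" where
  "cycle_at e \<longleftrightarrow> gram e e * pot (e div k) = pot (e mod V)"

lemma unit_cycles_cycle_at: "unit_cycles \<longleftrightarrow> (\<forall>e<k * V. cycle_at e)"
  by (simp add: unit_cycles_def cycle_at_def)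

text \<open>The iteration for an edge \<open>0 < e < V\<close> of the spanning tree defines the potential at \<open>e\<close>, all
  others test it.\<close>
definition pot_inv :: "nat \<Rightarrow> cmem \<Rightarrow> nmem \<Rightarrow> bool" where
  "pot_inv j C R \<longleftrightarrow> has_table C \<and> (\<forall>v<V. v < j \<or> v = 0 \<longrightarrow> C (2 * size_in + v) = pot v) \<and>
     R 8 = (if \<forall>e<j. cycle_at e then 0 else 1)"

lemma pot_less: "0 < e \<Longrightarrow> pot e = gram e e * pot (e div k)"
  using two_states by (subst potential.simps) (simp add: mult.commute)

lemma has_table_upd: "has_table C \<Longrightarrow> i < 4 \<or> 2 * size_in \<le> i \<Longrightarrow> has_table (C(i := z))"
  using size_in_ge(1) by (auto simp: has_table_def)

text \<open>With edges taken in increasing order, every value looked up is already known: the source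
  satisfies \<open>j div k < j\<close> or is 0, and a tested edge has \<open>j = 0\<close> or
  \<open>V \<le> j\<close>, so its target is 0 or below \<open>j\<close>.\<close>

lemma wp_potential_body:
  assumes "env R" "index_arrays (k * V) A" "pot_inv j C R" "R 11 = j" "j < k * V"
  shows "wp potential_body (11 * k + 50) C R A
    (\<lambda>_ C' R' A'. pot_inv (Suc j) C' R' \<and> A' = A \<and> agree {8, 18, 19, 20, 21, 27} R' R)"
proof -
  let ?R = "R(20 := size_in + k * j, 21 := size_in + k * j)"
  have A: "A 0 j = j mod V" "A 2 j = j div k" "A 3 j = size_in + k * j"
    using assms(2,5) by (auto simp: index_arrays_def)
  have gram: "wp gram_code (11 * k + 3) C ?R A
    (\<lambda>_ C' R' A'. C' 1 = gram j j \<and> A' = A \<and> agree {1, 2, 3} C' C \<and> agree {20, 21, 27} R' ?R)"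
    by (rule wp_gram_code) (use assms in \<open>auto simp: env_def pot_inv_def\<close>)
  have src: "j div k < V" "j div k < j \<or> j div k = 0"
    using assms(5) k_pos two_states by (cases "j = 0"; simp add: div_less_iff_less_mult mult.commute)+
  have tgt: "j mod V < V" "V \<le> j \<Longrightarrow> j mod V < j" "j < V \<Longrightarrow> j mod V = j"
    using V_pos mod_less_divisor[OF V_pos, of j] by (auto simp del: mod_less_divisor)
  have C: "C (2 * size_in + j div k) = pot (j div k)"
    using assms(3) src by (auto simp: pot_inv_def)
  show ?thesis
    unfolding potential_body_def
    apply (rule wp_ALoad_Seq, simp, simp, simp, simp)
    apply (rule wp_ALoad_Seq, simp, simp, simp, simp, simp only: A assms(4) fun_upd_apply)
    apply (simp add: assms(4) A fun_upd_def del: One_nat_def)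
    apply (rule wp_Call_Seq[OF gram[unfolded fun_upd_def]], simp)
    apply (elim conjE)
    subgoal premises prems for T' C1 R1 A1
    proof -
      have R1: "R1 11 = j" "R1 6 = 2 * size_in" "R1 7 = 1" "R1 3 = V" "R1 8 = R 8"
        "agree {8, 18, 19, 20, 21, 27} R1 R"
        using prems assms(1,4) by (auto simp: agree_def env_def)
      have C1: "C1 1 = gram j j" "\<And>m. 4 \<le> m \<Longrightarrow> C1 m = C m"
        using prems by (auto simp: agree_def)
      have C1t: "has_table C1" "C1 (2 * size_in + j div k) = pot (j div k)"
        "\<And>v. v < V \<Longrightarrow> v < j \<or> v = 0 \<Longrightarrow> C1 (2 * size_in + v) = pot v"
        using assms(3) C C1(2) size_in_ge(1) by (auto simp: has_table_def pot_inv_def)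
      have flag: "R 8 = (if \<forall>e<j. cycle_at e then 0 else 1)" using assms(3) by (simp add: pot_inv_def)
      have all: "(\<forall>e<Suc j. cycle_at e) \<longleftrightarrow> (\<forall>e<j. cycle_at e) \<and> cycle_at j"
        by (auto simp: less_Suc_eq)
      have A1: "A1 = A" and T': "35 \<le> T'" using prems(1,3) by auto
      have n: "2 * size_in + v \<noteq> 1" "2 * size_in + v \<noteq> 2" for v using size_in_ge(1) by auto
      let ?C = "C1(2 := pot (j div k), 1 := gram j j * pot (j div k))"
      let ?R = "R1(19 := 2 * size_in + j div k, 18 := 2 * size_in + j mod V)"
      let ?Q = "\<lambda>_ C' R' A'. pot_inv (Suc j) C' R' \<and> A' = A \<and> agree {8, 18, 19, 20, 21, 27} R' R"
      have core: "wp (If (TLe 7 11) (If (TLe 3 11) check_code (Prim (CStore 1 18))) check_code) (T' - 16) ?C ?R A ?Q"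
      proof (cases "0 < j \<and> j < V")
        case True
        \<comment> \<open>A tree edge satisfies its equation by the recursion of \<open>pot\<close>,
          so storing the value replaces the test.\<close>
        then have "cycle_at j" "gram j j * pot (j div k) = pot j"
          using pot_less[of j] tgt(3) by (auto simp: cycle_at_def)
        moreover have "C1 (2 * size_in) = pot 0" using C1t(3)[of 0] V_pos by simp
        ultimately show ?thesis
          apply (intro wp_If vc_wp; (simp add: R1 del: One_nat_def)?)
          using True T' size_in_ge(1) apply (auto simp: R1 tgt n has_table_upd C1t pot_inv_def all flag less_Suc_eq simp del: One_nat_def)
          done
      next
        case False
        then have t: "j mod V < j \<or> j mod V = 0" using tgt V_pos by (cases "j = 0") auto
        have "cycle_at j \<longleftrightarrow> C1 1 * C1 (2 * size_in + j div k) = C1 (2 * size_in + j mod V)"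
          using C1t C1(1) t tgt(1) by (simp add: cycle_at_def)
        then have cyc: "cycle_at j \<longleftrightarrow> gram j j * pot (j div k) = C1 (2 * size_in + j mod V)"
          using C1 C1t by simp
        have pv: "C1 (2 * size_in + v) = pot v" if "v < V" "v < Suc j \<or> v = 0" for v
          using False that C1t(3) by (metis less_Suc_eq neq0_conv)
        have j: "1 \<le> j \<Longrightarrow> V \<le> j" using False by auto
        have chk: "vc check_code T2 (C1(2 := x, 1 := gram j j * pot (j div k)))
            (R1(19 := y, 18 := 2 * size_in + j mod V)) A
          (\<lambda>_ C' R' A'. pot_inv (Suc j) C' R' \<and> A' = A \<and> agree {8, 18, 19, 20, 21, 27} R' R)"
          if "5 \<le> T2" for T2 x y
          using that C1t(3)[of 0] V_pos size_in_ge(1)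
          by (auto simp: check_code_def R1 n has_table_upd C1t(1) pot_inv_def all flag cyc pv simp del: One_nat_def)
        show ?thesis
          apply (rule wp_If, simp, use T' in simp)
          subgoal premises le
          proof -
            have "V \<le> j" using le j by (simp add: R1 del: One_nat_def)
            then show ?thesis
              apply (intro wp_If; (simp add: R1 del: One_nat_def)?)
              using T' apply simp
              apply (rule vc_wp, rule chk, use T' in simp)
              done
          qed
          apply (rule vc_wp, rule chk, use T' in simp)
          done
      qed
      show ?thesis
        apply (rule wp_ALoad_Seq, simp, simp, simp, use T' in simp)
        apply (rule wp_Prim_Seq, simp, use T' in simp, simp only: prim_c.simps prim_n.simps)+
        apply (rule wp_ALoad_Seq, simp, simp, simp, use T' in simp)
        apply (rule wp_Prim_Seq, simp, use T' in simp, simp only: prim_c.simps prim_n.simps)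
        using core apply (simp add: A1 R1 A n C1(1) C1t(2) del: One_nat_def)
        done
    qed
    done
qed

lemma env_agree: "env R \<Longrightarrow> agree X R' R \<Longrightarrow> X \<inter> {0, 3, 4, 5, 6, 7, 10} = {} \<Longrightarrow> env R'"
  by (auto simp: env_def agree_def)

lemma wp_potential_code:
  assumes "env R" "index_arrays (k * V) A" "has_table C" "R 8 = 0"
  shows "wp potential_code ((11 * k + 54) * (k * V) + 4) C R A
    (\<lambda>_ C' R' A'. has_table C' \<and> R' 8 = (if unit_cycles then 0 else 1) \<and> A' = A \<and>
       agree {8, 11, 18, 19, 20, 21, 27} R' R)"
proof -
  let ?X = "{8, 11, 18, 19, 20, 21, 27}"
  let ?Inv = "\<lambda>j C' R' A'. pot_inv j C' R' \<and> A' = A \<and> agree ?X R' R"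
  let ?C = "C(0 := 1, 2 * size_in := 1)"
  have init: "pot_inv 0 ?C (R(11 := 0))"
    using assms(3,4) size_in_ge(1) by (simp add: pot_inv_def has_table_upd potential.simps)
  have loop: "wp (For 11 4 potential_body) ((11 * k + 50 + 4) * R 4 + 2) ?C R A (\<lambda>_. ?Inv (R 4))"
  proof (rule wp_For)
    fix j C' R' A'
    assume j: "j < R 4" "?Inv j C' R' A'" "R' 11 = j" "R' 4 = R 4"
    have e: "env R'" using assms(1) j(2) by (auto intro: env_agree)
    have "j < k * V" using j(1) assms(1) by (simp add: env_def)
    then have "wp potential_body (11 * k + 50) C' R' A
      (\<lambda>_ C'' R'' A''. pot_inv (Suc j) C'' R'' \<and> A'' = A \<and> agree {8, 18, 19, 20, 21, 27} R'' R')"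
      using wp_potential_body[OF e assms(2), of j C'] j by auto
    then have "wp potential_body (11 * k + 50) C' R' A
       (\<lambda>_ C'' R'' A''. R'' 11 = j \<and> R'' 4 = R 4 \<and> ?Inv (Suc j) C'' (R''(11 := Suc j)) A'')"
      by (rule wp_conseq) (use j in \<open>auto simp: agree_def pot_inv_def\<close>)
    then show "wp potential_body (11 * k + 50) C' R' A'
       (\<lambda>_ C'' R'' A''. R'' 11 = j \<and> R'' 4 = R 4 \<and> ?Inv (Suc j) C'' (R''(11 := Suc j)) A'')"
      using j by simp
  qed (use init in \<open>auto simp: fun_upd_def\<close>)
  have R: "R 6 = 2 * size_in" "R 4 = k * V" using assms(1) by (auto simp: env_def)
  show ?thesis
    unfolding potential_code_def
    apply (rule wp_Prim_Seq, simp, simp, simp only: prim_c.simps prim_n.simps)+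
    apply (simp only: R(1) fun_upd_same)
    apply (rule wp_conseq[OF loop])
     apply (simp_all add: R unit_cycles_cycle_at pot_inv_def)
    done
qed


text \<open>Breadth-first search of the pair graph: the state is the queue of all pairs discovered so far
  together with a flag that records a violation.\<close>
fun visit :: "nat \<times> nat \<Rightarrow> (nat \<times> nat) list \<times> bool \<Rightarrow> (nat \<times> nat) list \<times> bool" where
  "visit (e, e') (qs, b) =
     (if gram e e' = 0 then (qs, b)
      else ((if (e mod V, e' mod V) \<in> set qs then qs else qs @ [(e mod V, e' mod V)]),
            b \<or> e mod V = e' mod V \<and> e \<noteq> e'))"

definition edges :: "nat \<times> nat \<Rightarrow> (nat \<times> nat) list" where
  "edges p = concat (map (\<lambda>x. map (\<lambda>y. (k * fst p + x, k * snd p + y)) [0..<k]) [0..<k])"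

text \<open>Round \<open>h\<close> expands the queue entry at position \<open>h\<close> and is idle
  if there is none, so the number of rounds can be fixed in advance.\<close>

fun search :: "nat \<Rightarrow> bool \<Rightarrow> (nat \<times> nat) list \<times> bool" where
  "search 0 b = (map (\<lambda>u. (u, u)) [0..<V], b)"
| "search (Suc h) b =
     (if h < length (fst (search h b)) then fold visit (edges (fst (search h b) ! h)) (search h b)
      else search h b)"

lemma set_edges: "set (edges (u, v)) = {(k * u + x, k * v + y) |x y. x < k \<and> y < k}"
  by (auto simp: edges_def)

definition target :: "nat \<times> nat \<Rightarrow> nat \<times> nat" where
  "target p = (fst p mod V, snd p mod V)"

definition violation :: "nat \<times> nat \<Rightarrow> bool" where
  "violation p \<longleftrightarrow> gram (fst p) (snd p) \<noteq> 0 \<and> fst p mod V = snd p mod V \<and> fst p \<noteq> snd p"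

lemma fold_visit:
  assumes "fold visit es (qs, b) = (qs', b')" "distinct qs"
  shows "(\<exists>ext. qs' = qs @ ext) \<and> distinct qs' \<and>
    set qs' = set qs \<union> target ` {p \<in> set es. gram (fst p) (snd p) \<noteq> 0} \<and>
    (b' \<longleftrightarrow> b \<or> (\<exists>p\<in>set es. violation p))"
  using assms
proof (induction es arbitrary: qs b)
  case (Cons p es)
  obtain e e' where p: "p = (e, e')" by (cases p)
  obtain qs1 b1 where v: "visit p (qs, b) = (qs1, b1)" by (cases "visit p (qs, b)")
  have "fold visit es (qs1, b1) = (qs', b')" using Cons.prems(1) v by simp
  moreover have "distinct qs1" "\<exists>ext. qs1 = qs @ ext"
    "set qs1 = set qs \<union> target ` {p' \<in> {p}. gram (fst p') (snd p') \<noteq> 0}"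
    "b1 \<longleftrightarrow> b \<or> violation p"
    using v Cons.prems(2) by (auto simp: p target_def violation_def split: if_splits)
  ultimately show ?case using Cons.IH[of qs1 b1] by auto
qed auto


definition processed :: "nat \<Rightarrow> (nat \<times> nat) list \<Rightarrow> (nat \<times> nat) set" where
  "processed h qs = {p. \<exists>i<h. i < length qs \<and> p \<in> set (edges (qs ! i))}"

lemma search_invariant:
  assumes "search h b = (qs, b')"
  shows "distinct qs \<and> set qs \<subseteq> {(u, v). reachable u v} \<and> (\<forall>u<V. (u, u) \<in> set qs) \<and>
    target ` {p \<in> processed h qs. gram (fst p) (snd p) \<noteq> 0} \<subseteq> set qs \<and>
    (b' \<longleftrightarrow> b \<or> (\<exists>p\<in>processed h qs. violation p))"
  using assms
proof (induction h arbitrary: qs b')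
  case 0
  show ?case
    using 0 by (auto simp: processed_def distinct_map inj_on_def reachable.diagonal)
next
  case (Suc h)
  obtain qs0 b0 where s: "search h b = (qs0, b0)" by (cases "search h b")
  note IH = Suc.IH[OF s]
  show ?case
  proof (cases "h < length qs0")
    case False
    then have pr: "processed (Suc h) qs0 = processed h qs0"
      by (auto simp: processed_def less_Suc_eq)
    have "qs = qs0 \<and> b' = b0" using Suc.prems s False by simp
    then show ?thesis using IH pr by simp
  next
    case True
    then have "fold visit (edges (qs0 ! h)) (qs0, b0) = (qs, b')" using Suc.prems s by simp
    from fold_visit[OF this] IH obtain ext where
      f: "qs = qs0 @ ext" "distinct qs"
        "set qs = set qs0 \<union> target ` {p \<in> set (edges (qs0 ! h)). gram (fst p) (snd p) \<noteq> 0}"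
        "b' \<longleftrightarrow> b0 \<or> (\<exists>p\<in>set (edges (qs0 ! h)). violation p)" by auto
    \<comment> \<open>The queue grows only at its end, so the entries expanded earlier keep their
      positions.\<close>
    have pr: "processed (Suc h) qs = processed h qs0 \<union> set (edges (qs0 ! h))"
      using True by (auto simp: processed_def f(1) nth_append less_Suc_eq)
    obtain u v where uv: "qs0 ! h = (u, v)" by (cases "qs0 ! h")
    have "reachable u v" using IH uv True nth_mem[of h qs0] by auto
    then have "target ` {p \<in> set (edges (qs0 ! h)). gram (fst p) (snd p) \<noteq> 0} \<subseteq> {(u, v). reachable u v}"
      by (auto simp: uv set_edges target_def intro: reachable.step)
    then show ?thesis unfolding pr using IH f by auto
  qed
qed

text \<open>The queue has no repetitions and at most \<open>V * V\<close> possible entries, so after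
  \<open>V * V\<close> rounds all of them have been expanded. It is then closed under steps and
  consists of exactly the reachable pairs.\<close>

lemma search_final:
  "snd (search (V * V) b) \<longleftrightarrow> b \<or> \<not> no_merging"
proof -
  obtain qs b' where s: "search (V * V) b = (qs, b')" by (cases "search (V * V) b")
  note I = search_invariant[OF s]
  have "set qs \<subseteq> {..<V} \<times> {..<V}" using I reachable_less by auto
  then have "card (set qs) \<le> V * V" using card_mono[of "{..<V} \<times> {..<V}"] by simp
  then have "length qs \<le> V * V" using I by (simp add: distinct_card)
  then have pr: "processed (V * V) qs = (\<Union>p\<in>set qs. set (edges p))"
  proof (intro set_eqI iffI)
    fix p assume "p \<in> (\<Union>p\<in>set qs. set (edges p))"
    then obtain i where "i < length qs" "p \<in> set (edges (qs ! i))" by (auto simp: set_conv_nth[of qs])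
    then show "p \<in> processed (V * V) qs"
      unfolding processed_def using \<open>length qs \<le> V * V\<close> by (intro CollectI exI[of _ i]) simp
  next
    fix p assume "p \<in> processed (V * V) qs"
    then show "p \<in> (\<Union>p\<in>set qs. set (edges p))"
      unfolding processed_def using nth_mem by blast
  qed
  have "(u, v) \<in> set qs" if "reachable u v" for u v
    using that
  proof (induction rule: reachable.induct)
    case (diagonal u)
    then show ?case using I by simp
  next
    case (step u v x y)
    have "(k * u + x, k * v + y) \<in> processed (V * V) qs"
      unfolding pr using step(5) step(2,3) by (intro UN_I[of "(u, v)"]) (auto simp: set_edges)
    then have "(k * u + x, k * v + y) \<in> {p \<in> processed (V * V) qs. gram (fst p) (snd p) \<noteq> 0}"
      using step(4) by simp
    then have "target (k * u + x, k * v + y) \<in> set qs" using I by blast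
    then show ?case by (simp add: target_def)
  qed
  then have "set qs = {(u, v). reachable u v}" using I by auto
  then have "(\<exists>p\<in>processed (V * V) qs. violation p) \<longleftrightarrow> \<not> no_merging"
    unfolding pr no_merging_def violation_def by (fastforce simp: set_edges)
  then show ?thesis using I s by simp
qed

end

section \<open>The search of the pair graph on the machine\<close>

definition flag_code :: com where
  "flag_code = If (TLe 22 23) (If (TLe 23 22)
     (If (TLe 18 19) (If (TLe 19 18) Skip (Prim (NConst 8 1))) (Prim (NConst 8 1))) Skip) Skip"

text \<open>The mark of the pair \<open>(u, v)\<close> is stored at \<open>V * u + v\<close>. Array
  1, read at the edge in register 18, supplies \<open>V * u\<close>, so the inner loop needs no
  multiplication.\<close>

definition push_code :: com where
  "push_code = (ALoad 24 1 18 ;; Prim (NAdd 24 24 23) ;; ALoad 25 6 24 ;;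
     If (TLe 7 25) Skip (AStore 4 9 22 ;; AStore 5 9 23 ;; AStore 6 24 7 ;; Prim (NAdd 9 9 7)))"

definition visit_code :: com where
  "visit_code = (Prim (NAdd 18 14 16) ;; Prim (NAdd 19 15 17) ;; ALoad 20 3 18 ;; ALoad 21 3 19 ;;
     gram_code ;; Prim (CConst 2 0) ;;
     If (TEq 1 2) Skip (ALoad 22 0 18 ;; ALoad 23 0 19 ;; flag_code ;; push_code))"

context lqca
begin

definition queue :: "(nat \<times> nat) list \<times> bool \<Rightarrow> nmem \<Rightarrow> amem \<Rightarrow> bool" where
  "queue s R A \<longleftrightarrow> (case s of (qs, b) \<Rightarrow>
     R 9 = length qs \<and> R 8 = (if b then 1 else 0) \<and>
     (\<forall>i<length qs. A 4 i = fst (qs ! i) \<and> A 5 i = snd (qs ! i)) \<and>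
     (\<forall>u<V. \<forall>v<V. A 6 (V * u + v) = (if (u, v) \<in> set qs then 1 else 0)) \<and>
     set qs \<subseteq> {..<V} \<times> {..<V} \<and> index_arrays (k * V) A)"

lemma queue_regs: "queue s R A \<Longrightarrow> R' 8 = R 8 \<Longrightarrow> R' 9 = R 9 \<Longrightarrow> queue s R' A"
  by (auto simp: queue_def split: prod.splits)

text \<open>Guarantees that setting the mark of one pair leaves the marks of all others
  intact.\<close>

lemma pair_index_inj: "u < V \<Longrightarrow> v < V \<Longrightarrow> u' < V \<Longrightarrow> v' < V \<Longrightarrow> V * u + v = V * u' + v' \<longleftrightarrow> u = u' \<and> v = v'"
proof
  assume *: "v < V" "v' < V" "V * u + v = V * u' + v'"
  have "(V * u + v) div V = u" "(V * u' + v') div V = u'" "(V * u + v) mod V = v" "(V * u' + v') mod V = v'"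
    using *(1,2) by auto
  then show "u = u' \<and> v = v'" using *(3) by metis
qed simp

lemma queue_push:
  assumes "queue (qs, b) R A" "u < V" "v < V" "(u, v) \<notin> set qs"
  shows "queue (qs @ [(u, v)], b) (R(9 := Suc (R 9)))
    (A(4 := (A 4)(R 9 := u), 5 := (A 5)(R 9 := v), 6 := (A 6)(V * u + v := 1)))"
  using assms pair_index_inj[OF _ _ assms(2,3)]
  by (auto simp: queue_def nth_append index_arrays_def)

lemma wp_push_code:
  assumes "queue (qs, b) R A" "R 7 = 1" "e < k * V" "R 18 = e" "R 22 = e mod V" "R 23 = e' mod V"
  shows "wp push_code 40 C R A (\<lambda>_ C' R' A'. C' = C \<and> agree {9, 24, 25} R' R \<and>
    queue (if (e mod V, e' mod V) \<in> set qs then qs else qs @ [(e mod V, e' mod V)], b) R' A')"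
proof -
  let ?u = "e mod V" and ?v = "e' mod V"
  have uv: "?u < V" "?v < V" using V_pos by auto
  have A: "A 1 e = V * ?u" "A 6 (V * ?u + ?v) = (if (?u, ?v) \<in> set qs then 1 else 0)"
    using assms(1,3) uv by (auto simp: queue_def index_arrays_def)
  show ?thesis
  proof (cases "(?u, ?v) \<in> set qs")
    case True
    then show ?thesis using assms(2,4-6) A queue_regs[OF assms(1)]
      by (intro vc_wp) (simp add: push_code_def)
  next
    case False
    have q: "queue (qs @ [(?u, ?v)], b) (R(24 := V * ?u + ?v, 25 := 0, 9 := Suc (R 9)))
      (A(4 := (A 4)(R 9 := ?u), 5 := (A 5)(R 9 := ?v), 6 := (A 6)(V * ?u + ?v := 1)))"
      by (rule queue_regs[OF queue_push[OF assms(1) uv False]]) auto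
    show ?thesis using assms(2,4-6) A False q
      by (intro vc_wp) (simp add: push_code_def)
  qed
qed

text \<open>The machine compares index registers only by order, so each equality is tested by two
  inequalities.\<close>

lemma wp_flag_code:
  "wp flag_code 7 C R A (\<lambda>_ C' R' A'. C' = C \<and> A' = A \<and>
    R' = R(8 := (if R 22 = R 23 \<and> R 18 \<noteq> R 19 then 1 else R 8)))"
  by (rule vc_wp) (auto simp: flag_code_def)

lemma wp_visit_code:
  assumes "env R" "has_table C" "queue (qs, b) R A" "R 14 + R 16 = e" "R 15 + R 17 = e'"
    "e < k * V" "e' < k * V"
  shows "wp visit_code (11 * k + 100) C R A (\<lambda>_ C' R' A'. has_table C' \<and>
    agree {8, 9, 18, 19, 20, 21, 22, 23, 24, 25, 27} R' R \<and> queue (visit (e, e') (qs, b)) R' A')"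
proof -
  let ?R = "R(18 := e, 19 := e', 20 := size_in + k * e, 21 := size_in + k * e')"
  have A: "A 0 e = e mod V" "A 0 e' = e' mod V" "A 3 e = size_in + k * e" "A 3 e' = size_in + k * e'"
    using assms(3,6,7) by (auto simp: queue_def index_arrays_def)
  have gram: "wp gram_code (11 * k + 3) C ?R A
    (\<lambda>_ C' R' A'. C' 1 = gram e e' \<and> A' = A \<and> agree {1, 2, 3} C' C \<and> agree {20, 21, 27} R' ?R)"
    by (rule wp_gram_code) (use assms in \<open>auto simp: env_def\<close>)
  show ?thesis
    unfolding visit_code_def
    apply (rule wp_Prim_Seq, simp, simp, simp only: prim_c.simps prim_n.simps assms(4))
    apply (rule wp_Prim_Seq, simp, simp, simp add: assms(5) del: One_nat_def visit.simps)
    apply (rule wp_ALoad_Seq, simp, simp, simp, simp del: visit.simps)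
    apply (rule wp_ALoad_Seq, simp, simp, simp, simp del: visit.simps)
    apply (simp add: A del: One_nat_def visit.simps)
    apply (rule wp_Call_Seq[OF gram], simp del: visit.simps)
    apply (elim conjE)
    subgoal premises prems for T' C1 R1 A1
    proof -
      have T': "80 \<le> T'" using prems(1) by simp
      have C1: "has_table (C1(2 := 0))" "C1 1 = gram e e'"
        using prems assms(2) size_in_ge(1) by (auto simp: has_table_def agree_def)
      have R1: "R1 18 = e" "R1 19 = e'" "R1 7 = 1" "R1 8 = R 8" "R1 9 = R 9"
        "agree {8, 9, 18, 19, 20, 21, 22, 23, 24, 25, 27} R1 R"
        using prems assms(1) by (auto simp: agree_def env_def)
      have A1: "A1 = A" using prems by simp
      let ?Q = "\<lambda>_ C' R' A'. has_table C' \<and>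
        agree {8, 9, 18, 19, 20, 21, 22, 23, 24, 25, 27} R' R \<and> queue (visit (e, e') (qs, b)) R' A'"
      have q1: "queue (qs, b) R1 A" using queue_regs[OF assms(3)] R1 by simp
      show ?thesis
      proof (cases "gram e e' = 0")
        case True
        then show ?thesis using T' R1 C1 A1 q1
          by (intro vc_wp) (simp del: One_nat_def)
      next
        case False
        let ?R2 = "R1(22 := e mod V, 23 := e' mod V)"
        let ?b = "b \<or> e mod V = e' mod V \<and> e \<noteq> e'"
        let ?R3 = "?R2(8 := (if ?R2 22 = ?R2 23 \<and> ?R2 18 \<noteq> ?R2 19 then 1 else ?R2 8))"
        have q3: "queue (qs, ?b) ?R3 A"
          using q1 R1(1,2) by (auto simp: queue_def)
        have push: "wp push_code 40 (C1(2 := 0)) ?R3 A (\<lambda>_ C' R' A'. C' = C1(2 := 0) \<and> agree {9, 24, 25} R' ?R3 \<and>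
          queue (if (e mod V, e' mod V) \<in> set qs then qs else qs @ [(e mod V, e' mod V)], ?b) R' A')"
          by (rule wp_push_code) (use q3 R1 assms(6) in \<open>auto simp del: One_nat_def\<close>)
        have rest: "wp (ALoad 22 0 18 ;; ALoad 23 0 19 ;; flag_code ;; push_code) (T' - 3) (C1(2 := 0)) R1 A ?Q"
          apply (rule wp_ALoad_Seq, simp, simp, simp, use T' in \<open>simp del: visit.simps\<close>)
          apply (rule wp_ALoad_Seq, simp, simp, simp, use T' in \<open>simp del: visit.simps\<close>)
          apply (simp add: R1(1,2) A del: One_nat_def visit.simps)
          apply (rule wp_Call_Seq[OF wp_flag_code], use T' in \<open>simp del: visit.simps\<close>)
          apply (elim conjE, simp only:)
          apply (rule wp_conseq[OF push])
          using T' apply simp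
          using False C1 R1(6) apply (auto simp: agree_def simp del: One_nat_def)
          done
        show ?thesis
          apply (rule wp_Prim_Seq, simp, use T' in simp, simp only: prim_c.simps prim_n.simps)
          apply (rule wp_If, simp, use T' in \<open>simp del: visit.simps\<close>)
          using False rest C1 A1 apply (simp_all del: One_nat_def)
          done
      qed
    qed
    done
qed

end

text \<open>The row address of the number \<open>u\<close>, read as an edge, is
  \<open>size_in + k * u\<close>. Subtracting \<open>size_in\<close> yields \<open>k * u\<close>,
  the first edge leaving the vertex \<open>u\<close>.\<close>

definition process_code :: com where
  "process_code = (ALoad 12 4 11 ;; ALoad 13 5 11 ;; ALoad 14 3 12 ;; Prim (NSub 14 14 5) ;;
     ALoad 15 3 13 ;; Prim (NSub 15 15 5) ;; For 16 0 (For 17 0 visit_code))"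

definition search_code :: com where
  "search_code = For 11 10 (If (TLe 9 11) Skip process_code)"

definition start_code :: com where
  "start_code = (Prim (NConst 9 0) ;; For 11 3 (AStore 4 9 11 ;; AStore 5 9 11 ;; ALoad 12 1 11 ;;
     Prim (NAdd 12 12 11) ;; AStore 6 12 7 ;; Prim (NAdd 9 9 7)))"

context lqca
begin

text \<open>\<open>row\<close> and \<open>rows\<close> give the parts of \<open>edges\<close>
  already visited at given values of the inner and the outer loop counter.\<close>

definition row :: "nat \<times> nat \<Rightarrow> nat \<Rightarrow> nat \<Rightarrow> (nat \<times> nat) list" where
  "row p x n = map (\<lambda>y. (k * fst p + x, k * snd p + y)) [0..<n]"

definition rows :: "nat \<times> nat \<Rightarrow> nat \<Rightarrow> (nat \<times> nat) list" where
  "rows p n = concat (map (\<lambda>x. row p x k) [0..<n])"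

lemma rows_k: "rows p k = edges p"
  by (simp add: rows_def row_def edges_def)

lemma edge_less: "u < V \<Longrightarrow> x < k \<Longrightarrow> k * u + x < k * V"
proof -
  assume "u < V" "x < k"
  then have "k * u + x < k * (u + 1)" by simp
  also have "\<dots> \<le> k * V" using \<open>u < V\<close> by (intro mult_le_mono2) simp
  finally show ?thesis .
qed

abbreviation scratch :: "nat set" where
  "scratch \<equiv> {8, 9, 18, 19, 20, 21, 22, 23, 24, 25, 27}"

lemma wp_row:
  assumes "env R" "has_table C" "queue s R A" "R 14 = k * u" "R 15 = k * v" "R 16 = x"
    "u < V" "v < V" "x < k"
  shows "wp (For 17 0 visit_code) ((11 * k + 104) * k + 2) C R A (\<lambda>_ C' R' A'. has_table C' \<and>
    agree (insert 17 scratch) R' R \<and> queue (fold visit (row (u, v) x k) s) R' A')"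
proof -
  let ?Inv = "\<lambda>j C' R' A'. has_table C' \<and> agree (insert 17 scratch) R' R \<and>
    queue (fold visit (row (u, v) x j) s) R' A'"
  have R0: "R 0 = k" using assms(1) by (simp add: env_def)
  have "wp (For 17 0 visit_code) ((11 * k + 100 + 4) * R 0 + 2) C R A (\<lambda>_. ?Inv (R 0))"
  proof (rule wp_For)
    show "?Inv 0 C (R(17 := 0)) A"
      using assms(2) queue_regs[OF assms(3), of "R(17 := 0)"] by (simp add: row_def)
    fix j C' R' A'
    assume j: "j < R 0" "?Inv j C' R' A'" "R' 17 = j" "R' 0 = R 0"
    obtain qs b where s: "fold visit (row (u, v) x j) s = (qs, b)" by fastforce
    have e: "env R'" using assms(1) j(2) by (auto intro: env_agree)
    have R': "R' 14 + R' 16 = k * u + x" "R' 15 + R' 17 = k * v + j"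
      using j assms(4-6) by (auto simp: agree_def)
    have "wp visit_code (11 * k + 100) C' R' A' (\<lambda>_ C'' R'' A''. has_table C'' \<and>
       agree scratch R'' R' \<and> queue (visit (k * u + x, k * v + j) (qs, b)) R'' A'')"
      by (rule wp_visit_code[OF e _ _ R']) (use j s assms edge_less R0 in auto)
    then show "wp visit_code (11 * k + 100) C' R' A'
       (\<lambda>_ C'' R'' A''. R'' 17 = j \<and> R'' 0 = R 0 \<and> ?Inv (Suc j) C'' (R''(17 := Suc j)) A'')"
    proof (rule wp_conseq)
      fix T' C'' R'' A''
      assume q: "has_table C'' \<and> agree scratch R'' R' \<and> queue (visit (k * u + x, k * v + j) (qs, b)) R'' A''"
      have "queue (visit (k * u + x, k * v + j) (qs, b)) (R''(17 := Suc j)) A''"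
        using q queue_regs[of _ R'' A'' "R''(17 := Suc j)"] by simp
      moreover have "fold visit (row (u, v) x (Suc j)) s = visit (k * u + x, k * v + j) (qs, b)"
        using s by (simp add: row_def del: visit.simps)
      moreover have "agree (insert 17 scratch) R'' R" using q j(2) by (simp add: agree_def)
      ultimately show "R'' 17 = j \<and> R'' 0 = R 0 \<and> ?Inv (Suc j) C'' (R''(17 := Suc j)) A''"
        using q j by (simp add: agree_def)
    qed simp
  qed auto
  then show ?thesis by (rule wp_conseq) (use R0 in auto)
qed

abbreviation process_regs :: "nat set" where
  "process_regs \<equiv> insert 12 (insert 13 (insert 14 (insert 15 (insert 16 (insert 17 scratch)))))"

lemma wp_process_code:
  assumes "env R" "has_table C" "queue (qs, b) R A" "R 11 = h" "h < length qs"
  shows "wp process_code ((11 * k + 104) * k * k + 6 * k + 30) C R A (\<lambda>_ C' R' A'. has_table C' \<and>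
    agree process_regs R' R \<and> queue (fold visit (edges (qs ! h)) (qs, b)) R' A')"
proof -
  obtain u v where uv: "qs ! h = (u, v)" by (cases "qs ! h")
  then have less: "u < V" "v < V" using assms(3,5) nth_mem[of h qs] by (auto simp: queue_def)
  then have "u < k * V" "v < k * V" using size_in_ge(2) by linarith+
  then have A: "A 4 h = u" "A 5 h = v" "A 3 u = size_in + k * u" "A 3 v = size_in + k * v"
    using assms(3,5) uv by (auto simp: queue_def index_arrays_def)
  let ?R = "R(12 := u, 13 := v, 14 := k * u, 15 := k * v)"
  let ?Inv = "\<lambda>j C' R' A'. has_table C' \<and> agree process_regs R' R \<and> R' 14 = k * u \<and> R' 15 = k * v \<and>
    queue (fold visit (rows (u, v) j) (qs, b)) R' A'"
  have R: "R 0 = k" "R 5 = size_in" using assms(1) by (auto simp: env_def)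
  have loop: "wp (For 16 0 (For 17 0 visit_code)) (((11 * k + 104) * k + 2 + 4) * ?R 0 + 2) C ?R A (\<lambda>_. ?Inv (?R 0))"
  proof (rule wp_For)
    show "?Inv 0 C (?R(16 := 0)) A"
      using assms(2) queue_regs[OF assms(3), of "?R(16 := 0)"] by (simp add: rows_def)
    fix j C' R' A'
    assume j: "j < ?R 0" "?Inv j C' R' A'" "R' 16 = j" "R' 0 = ?R 0"
    have e: "env R'" using assms(1) j(2) by (auto intro: env_agree)
    have "wp (For 17 0 visit_code) ((11 * k + 104) * k + 2) C' R' A' (\<lambda>_ C'' R'' A''. has_table C'' \<and>
      agree (insert 17 scratch) R'' R' \<and>
      queue (fold visit (row (u, v) j k) (fold visit (rows (u, v) j) (qs, b))) R'' A'')"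
      by (rule wp_row[OF e]) (use j less R in auto)
    then show "wp (For 17 0 visit_code) ((11 * k + 104) * k + 2) C' R' A'
       (\<lambda>_ C'' R'' A''. R'' 16 = j \<and> R'' 0 = ?R 0 \<and> ?Inv (Suc j) C'' (R''(16 := Suc j)) A'')"
    proof (rule wp_conseq)
      fix T' C'' R'' A''
      assume q: "has_table C'' \<and> agree (insert 17 scratch) R'' R' \<and>
        queue (fold visit (row (u, v) j k) (fold visit (rows (u, v) j) (qs, b))) R'' A''"
      have "queue (fold visit (row (u, v) j k) (fold visit (rows (u, v) j) (qs, b))) (R''(16 := Suc j)) A''"
        using q queue_regs[of _ R'' A'' "R''(16 := Suc j)"] by simp
      moreover have "rows (u, v) (Suc j) = rows (u, v) j @ row (u, v) j k"
        by (simp add: rows_def)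
      moreover have "agree process_regs R'' R" using q j(2) by (simp add: agree_def)
      ultimately show "R'' 16 = j \<and> R'' 0 = ?R 0 \<and> ?Inv (Suc j) C'' (R''(16 := Suc j)) A''"
        using q j by (simp add: agree_def)
    qed simp
  qed auto
  have loop': "wp (For 16 0 (For 17 0 visit_code)) ((11 * k + 104) * k * k + 6 * k + 2) C ?R A (\<lambda>_. ?Inv k)"
    by (rule wp_conseq[OF loop]) (use R in \<open>auto simp: algebra_simps\<close>)
  show ?thesis
    unfolding process_code_def uv rows_k[symmetric]
    apply (rule wp_ALoad_Seq, simp, simp, simp, simp)+
    apply (rule wp_Prim_Seq, simp, simp, simp only: prim_c.simps prim_n.simps)
    apply (rule wp_ALoad_Seq, simp, simp, simp, simp)
    apply (rule wp_Prim_Seq, simp, simp, simp only: prim_c.simps prim_n.simps)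
    apply (simp add: A assms(4) R fun_upd_twist del: One_nat_def)
    apply (rule wp_conseq[OF loop'])
     apply auto
    done
qed

end

lemma wp_If_true:
  "holds t C R \<Longrightarrow> wp a (T - 1) C R A Q \<Longrightarrow> test_ok t \<Longrightarrow> 2 \<le> T \<Longrightarrow> wp (If t a b) T C R A Q"
  by (rule wp_If) auto

lemma wp_If_false:
  "\<not> holds t C R \<Longrightarrow> wp b (T - 2) C R A Q \<Longrightarrow> test_ok t \<Longrightarrow> 2 \<le> T \<Longrightarrow> wp (If t a b) T C R A Q"
  by (rule wp_If) auto

context lqca
begin

lemma wp_search_code:
  assumes "env R" "has_table C" "queue (search 0 b) R A"
  shows "wp search_code (((11 * k + 104) * k * k + 6 * k + 36) * (V * V) + 2) C R A
    (\<lambda>_ C' R' A'. R' 8 = (if b \<or> \<not> no_merging then 1 else 0))"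
proof -
  let ?Inv = "\<lambda>j C' R' A'. has_table C' \<and> agree (insert 11 process_regs) R' R \<and> queue (search j b) R' A'"
  define X where "X = (11 * k + 104) * k * k + 6 * k"
  let ?T = "X + 30"
  have R10: "R 10 = V * V" using assms(1) by (simp add: env_def)
  have "wp search_code ((?T + 2 + 4) * R 10 + 2) C R A (\<lambda>_. ?Inv (R 10))"
    unfolding search_code_def
  proof (rule wp_For)
    show "?Inv 0 C (R(11 := 0)) A"
      using assms(2) queue_regs[OF assms(3), of "R(11 := 0)"] by simp
    fix j C' R' A'
    assume j: "j < R 10" "?Inv j C' R' A'" "R' 11 = j" "R' 10 = R 10"
    have e: "env R'" using assms(1) j(2) by (auto intro: env_agree)
    obtain qs c where s: "search j b = (qs, c)" by fastforce
    have R9: "R' 9 = length qs" using j(2) s by (simp add: queue_def)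
    show "wp (If (TLe 9 11) Skip process_code) (?T + 2) C' R' A'
       (\<lambda>_ C'' R'' A''. R'' 11 = j \<and> R'' 10 = R 10 \<and> ?Inv (Suc j) C'' (R''(11 := Suc j)) A'')"
    proof (cases "j < length qs")
      case False
      then have st: "search (Suc j) b = search j b" using s by simp
      have "queue (search j b) (R'(11 := Suc j)) A'"
        using j(2) queue_regs[of _ R' A' "R'(11 := Suc j)"] by simp
      moreover have "holds (TLe 9 11) C' R'" using False j(3) R9 by simp
      ultimately show ?thesis using j unfolding st
        by - (rule wp_If_true, assumption, rule wp_Skip, simp_all)
    next
      case True
      then have st: "search (Suc j) b = fold visit (edges (qs ! j)) (qs, c)" using s by simp
      have "wp process_code ?T C' R' A' (\<lambda>_ C'' R'' A''. has_table C'' \<and> agree process_regs R'' R' \<and>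
          queue (fold visit (edges (qs ! j)) (qs, c)) R'' A'')"
        unfolding X_def by (rule wp_process_code[OF e]) (use True j s in auto)
      then have "wp process_code ?T C' R' A'
        (\<lambda>_ C'' R'' A''. R'' 11 = j \<and> R'' 10 = R 10 \<and> ?Inv (Suc j) C'' (R''(11 := Suc j)) A'')"
      proof (rule wp_conseq)
        fix T' C'' R'' A''
        assume q: "has_table C'' \<and> agree process_regs R'' R' \<and>
          queue (fold visit (edges (qs ! j)) (qs, c)) R'' A''"
        have "queue (search (Suc j) b) (R''(11 := Suc j)) A''"
          unfolding st using q queue_regs[of _ R'' A'' "R''(11 := Suc j)"] by simp
        then show "R'' 11 = j \<and> R'' 10 = R 10 \<and> ?Inv (Suc j) C'' (R''(11 := Suc j)) A''"
          using q j by (simp add: agree_def del: search.simps)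
      qed simp
      then have "wp process_code (?T + 2 - 2) C' R' A'
        (\<lambda>_ C'' R'' A''. R'' 11 = j \<and> R'' 10 = R 10 \<and> ?Inv (Suc j) C'' (R''(11 := Suc j)) A'')"
        by (simp only: diff_add_inverse2)
      moreover have "\<not> holds (TLe 9 11) C' R'" using True j(3) R9 by simp
      ultimately show ?thesis by - (rule wp_If_false, assumption, assumption, simp_all)
    qed
  qed auto
  then show ?thesis
  proof (rule wp_conseq)
    fix T' C' R' A'
    assume i: "?Inv (R 10) C' R' A'"
    obtain qs c where "search (V * V) b = (qs, c)" by fastforce
    then have "R' 8 = (if snd (search (V * V) b) then 1 else 0)"
      using i unfolding R10 by (simp add: queue_def)
    then show "R' 8 = (if b \<or> \<not> no_merging then 1 else 0)" by (simp only: search_final)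
  next
    show "(?T + 2 + 4) * R 10 + 2 \<le> ((11 * k + 104) * k * k + 6 * k + 36) * (V * V) + 2"
      unfolding R10 X_def[symmetric] by simp
  qed
qed

lemma wp_start_code:
  assumes "env R" "has_table C" "index_arrays (k * V) A" "\<And>i. A 6 i = 0" "R 8 = (if b then 1 else 0)"
  shows "wp start_code (30 * V + 3) C R A
    (\<lambda>_ C' R' A'. C' = C \<and> agree {9, 11, 12} R' R \<and> queue (search 0 b) R' A')"
proof -
  let ?qs = "\<lambda>j. map (\<lambda>u. (u, u)) [0..<j]"
  let ?Inv = "\<lambda>j C' R' A'. C' = C \<and> agree {9, 11, 12} R' R \<and> queue (?qs j, b) R' A'"
  let ?b = "AStore 4 9 11 ;; AStore 5 9 11 ;; ALoad 12 1 11 ;;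
     Prim (NAdd 12 12 11) ;; AStore 6 12 7 ;; Prim (NAdd 9 9 7)"
  have R: "R 3 = V" "R 7 = 1" using assms(1) by (auto simp: env_def)
  have loop: "wp (For 11 3 ?b) ((26 + 4) * (R(9 := 0)) 3 + 2) C (R(9 := 0)) A (\<lambda>_. ?Inv ((R(9 := 0)) 3))"
  proof (rule wp_For)
    show "?Inv 0 C (R(9 := 0, 11 := 0)) A"
      using assms(3-5) by (simp add: queue_def)
    fix j C' R' A'
    assume j: "j < (R(9 := 0)) 3" "?Inv j C' R' A'" "R' 11 = j" "R' 3 = (R(9 := 0)) 3"
    have jV: "j < V" using j(1) R by simp
    then have "j < k * V" using size_in_ge(2) by linarith
    \<comment> \<open>Since \<open>j < V\<close>, the residue tabulated for the edge
      \<open>j\<close> is \<open>j\<close> itself.\<close>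
    then have A1: "A' 1 j = V * j" using j(2) jV by (auto simp: queue_def index_arrays_def)
    have R': "R' 9 = j" "R' 7 = 1" using j(2) R by (auto simp: queue_def agree_def)
    have "queue (?qs j @ [(j, j)], b) (R'(9 := Suc (R' 9)))
      (A'(4 := (A' 4)(R' 9 := j), 5 := (A' 5)(R' 9 := j), 6 := (A' 6)(V * j + j := 1)))"
      by (rule queue_push) (use j(2) jV in auto)
    then have "queue (?qs (Suc j), b) (R'(12 := V * j + j, 9 := Suc j, 11 := Suc j))
      (A'(4 := (A' 4)(j := j), 5 := (A' 5)(j := j), 6 := (A' 6)(V * j + j := 1)))"
      using R' by - (rule queue_regs[where R = "R'(9 := Suc (R' 9))"], auto)
    then show "wp ?b 26 C' R' A'
       (\<lambda>_ C'' R'' A''. R'' 11 = j \<and> R'' 3 = (R(9 := 0)) 3 \<and> ?Inv (Suc j) C'' (R''(11 := Suc j)) A'')"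
      using j R' A1 by (intro vc_wp) simp
  qed auto
  show ?thesis
    unfolding start_code_def
    apply (rule wp_Prim_Seq, simp, simp, simp only: prim_c.simps prim_n.simps)
    apply (rule wp_conseq[OF loop])
     apply (auto simp: R)
    done
qed

end

section \<open>Assembly of the program and total running time\<close>

definition main_code :: com where
  "main_code = (Prim (NConst 7 1) ;; Prim (NConst 8 0) ;;
     If (TLe 0 7) Skip (power_code ;; copy_code ;; index_code ;; potential_code ;; start_code ;; search_code))"

definition decide :: "instr list" where
  "decide = (let c = compile main_code 0; l = length c in
     c @ [NConst 7 1, JmpNLe 7 8 (l + 3), Halt True, Halt False])"

lemma wp_decide:
  assumes "wp main_code T C R A (\<lambda>_ C' R' A'. R' 8 = (if b then 0 else 1))" "rep N R A"
  shows "\<exists>t\<le>T + 3. out ((step decide ^^ t) (mst 0 C N)) = Some b"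
proof -
  let ?c = "compile main_code 0"
  let ?l = "length ?c"
  let ?e = "[NConst 7 1, JmpNLe 7 8 (?l + 3), Halt True, Halt False]"
  have d: "decide = ?c @ ?e" by (simp add: decide_def Let_def)
  have "code_at decide 0 ?c" unfolding code_at_def d by auto
  then obtain t C' N' R' A' where t: "t \<le> T"
    "(step decide ^^ t) (mst 0 C N) = mst ?l C' N'" "rep N' R' A'" "R' 8 = (if b then 0 else 1)"
    using assms unfolding wp_def by fastforce
  have N8: "N' 8 = (if b then 0 else 1)" using rep_reg[OF t(3), of 8] t(4) by simp
  have n: "decide ! (?l + i) = ?e ! i" "?l + i < length decide" if "i < 4" for i
    using that unfolding d by (simp_all add: nth_append)
  have s1: "step decide (mst ?l C' N') = mst (?l + 1) C' (N'(7 := 1))"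
    using n[of 0] by (simp add: step_def)
  have s2: "step decide (mst (?l + 1) C' (N'(7 := 1))) = mst (if b then ?l + 2 else ?l + 3) C' (N'(7 := 1))"
    using n[of 1] N8 by (simp add: step_def)
  have s3: "out (step decide (mst (if b then ?l + 2 else ?l + 3) C' (N'(7 := 1)))) = Some b"
    using n[of 2] n[of 3] by (simp add: step_def numeral_3_eq_3)
  have "(step decide ^^ Suc (Suc (Suc t))) (mst 0 C N)
      = step decide (step decide (step decide ((step decide ^^ t) (mst 0 C N))))" by simp
  then have "out ((step decide ^^ Suc (Suc (Suc t))) (mst 0 C N)) = Some b"
    unfolding t(2) s1 s2 using s3 by simp
  then show ?thesis using t(1) by (intro exI[of _ "Suc (Suc (Suc t))"]) simp
qed

text \<open>There is just one configuration, and quiescence makes its column the unit vector.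
  \<open>main_code\<close> accepts this case at once, because the input has size 1 for every
  \<open>r\<close> and the time must not grow with \<open>r\<close>.\<close>

lemma well_formed_single_state:
  assumes "is_LQCA 1 r q \<delta>"
  shows "well_formed 1 q a r \<delta>"
proof -
  have q: "q = 0" and one: "\<delta> (replicate r 0) 0 = 1" using assms by (auto simp: is_LQCA_def)
  have c: "{d. is_config 1 q d} = {\<lambda>_. 0}"
    by (auto simp: is_config_def q)
  have "nbh a r (\<lambda>_. 0) i = replicate r 0" for i by (simp add: nbh_def map_replicate_const)
  then have "U a r \<delta> (\<lambda>_. 0) (\<lambda>_. 0) = 1" using one by (simp add: U_def)
  then have "((\<lambda>d. U a r \<delta> d (\<lambda>_. 0) * cnj (U a r \<delta> d (\<lambda>_. 0))) has_sum 1) {\<lambda>_. 0}"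
    using has_sum_finite[of "{\<lambda>_::int. 0::nat}" "\<lambda>d. U a r \<delta> d (\<lambda>_. 0) * cnj (U a r \<delta> d (\<lambda>_. 0))"]
    by simp
  moreover have "is_config 1 q d \<Longrightarrow> d = (\<lambda>_. 0)" for d using c by blast
  ultimately show ?thesis
    unfolding well_formed_def c by auto
qed

context lqca
begin

lemma size_in_power: "size_in = k ^ (r + 1)"
  by (simp add: size_in_def k_V)

text \<open>With \<open>size_in = k * k * V\<close>, the square has order \<open>k^4 * V^2\<close>,
  while the dominant term of the search is \<open>11 * k^3 * V^2\<close>. Every other term is
  bounded by a multiple of \<open>size_in\<close> or of its square, and the coefficients add up to
  less than 500.\<close>

lemma time_bound:
  "5 * k * r + 9 * r + 5 * k + 5 * V + 20 + (7 * size_in + 2) + (39 * (k * V) + 7) +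
   ((11 * k + 54) * (k * V) + 4) + (30 * V + 3) +
   (((11 * k + 104) * k * k + 6 * k + 36) * (V * V) + 2) + 4 \<le> 500 * size_in\<^sup>2"
proof -
  let ?n = size_in
  have kV: "k * V \<le> ?n" "V \<le> ?n" using size_in_ge(2,3) by linarith+
  have "1 \<le> V" using V_pos by simp
  have "k * 1 \<le> k * V" by (rule mult_le_mono2) fact
  then have k: "k \<le> ?n" using kV by linarith
  \<comment> \<open>Having two states bounds the loop over \<open>r\<close> by the size of the
    input.\<close>
  have "r < 2 ^ r" by simp
  also have "\<dots> \<le> k ^ r" using two_states by (rule power_mono) simp
  finally have rV: "r \<le> k * V" by (simp add: k_V)
  then have r: "r \<le> ?n" "k * r \<le> ?n" using kV mult_le_mono2[OF rV, of k] unfolding size_in_def by linarith+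
  have n1: "1 \<le> ?n" using size_in_ge(1) by simp
  have nn: "?n \<le> ?n\<^sup>2" using n1 by (simp add: power2_eq_square)
  have sq: "?n\<^sup>2 = k * k * k * k * (V * V)" by (simp add: size_in_def power2_eq_square)
  have a: "k * k * k * (V * V) \<le> ?n\<^sup>2"
    unfolding sq using two_states by (intro mult_le_mono1) simp
  have k1: "1 \<le> k" using two_states by simp
  have b: "k * k * (V * V) \<le> k * k * k * (V * V)"
    using k1 by (intro mult_le_mono1) simp
  have c: "k * (V * V) \<le> k * k * (V * V)"
    using k1 by (intro mult_le_mono1) simp
  have d: "V * V \<le> k * (V * V)" using k1 by simp
  have e: "((11 * k + 104) * k * k + 6 * k + 36) * (V * V)
    = 11 * (k * k * k * (V * V)) + 104 * (k * k * (V * V)) + 6 * (k * (V * V)) + 36 * (V * V)"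
    by (simp add: algebra_simps)
  have f: "(11 * k + 54) * (k * V) = 11 * ?n + 54 * (k * V)"
    by (simp add: algebra_simps size_in_def)
  have g: "5 * k * r = 5 * (k * r)" by simp
  show ?thesis unfolding e f g using kV k r n1 nn a b c d by linarith
qed

lemma wp_main_code:
  assumes "R 0 = k" "R 1 = r" "\<And>m. m < size_in \<Longrightarrow> C m = table m" "\<And>i j. A j i = 0"
  shows "wp main_code (500 * size_in\<^sup>2) C R A
    (\<lambda>_ C' R' A'. R' 8 = (if well_formed k q a r \<delta> then 0 else 1))"
proof -
  let ?T1 = "5 * k * r + 9 * r + 5 * k + 5 * V + 20"
  let ?T2 = "7 * size_in + 2"
  let ?T3 = "39 * (k * V) + 7"
  let ?T4 = "(11 * k + 54) * (k * V) + 4"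
  let ?T5 = "30 * V + 3"
  let ?T6 = "((11 * k + 104) * k * k + 6 * k + 36) * (V * V) + 2"
  let ?Q = "\<lambda>C' R' A'. R' 8 = (if well_formed k q a r \<delta> then 0 else 1)"
  define S where "S = 500 * size_in\<^sup>2"
  \<comment> \<open>The extra 4 covers the two constants set at the start and the failed test for a
    single state.\<close>
  have S: "?T1 + ?T2 + ?T3 + ?T4 + ?T5 + ?T6 + 4 \<le> S" unfolding S_def by (rule time_bound)
  let ?R = "R(7 := 1, 8 := 0)"
  have big: "wp (power_code ;; copy_code ;; index_code ;; potential_code ;; start_code ;; search_code)
    (S - 4) C ?R A (\<lambda>_. ?Q)"
  proof (rule wp_Call_Seq[OF wp_power_code])
    show "?R 0 = k" "?R 1 = r" using assms by auto
    show "?T1 \<le> S - 4" using S by linarith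
    fix T1 C1 R1 A1
    assume T1: "S - 4 - ?T1 \<le> T1" and "C1 = C \<and> A1 = A \<and> R1 3 = V \<and> R1 4 = k * V \<and> R1 5 = size_in \<and>
       R1 6 = 2 * size_in \<and> R1 10 = V * V \<and> agree {3, 4, 5, 6, 9, 10, 11, 12, 13} R1 ?R"
    then have 1: "C1 = C" "A1 = A" "env R1" "R1 8 = 0"
      using assms(1) by (auto simp: env_def agree_def)
    have T1: "?T2 + ?T3 + ?T4 + ?T5 + ?T6 \<le> T1" using S T1 by linarith
    show "wp (copy_code ;; index_code ;; potential_code ;; start_code ;; search_code) T1 C1 R1 A1 (\<lambda>_. ?Q)"
    proof (rule wp_Call_Seq[OF wp_copy_code])
      show "R1 5 = size_in" using 1 by (simp add: env_def)
      show "C1 m = table m" if "m < size_in" for m using 1 assms(3) that by simp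
      show "?T2 \<le> T1" using T1 by linarith
      fix T2 C2 R2 A2
      assume T2: "T1 - ?T2 \<le> T2" and "has_table C2 \<and> A2 = A1 \<and> agree {11, 12} R2 R1"
      then have 2: "has_table C2" "A2 = A" "env R2" "R2 8 = 0"
        using 1 by (auto simp: env_def agree_def)
      have T2: "?T3 + ?T4 + ?T5 + ?T6 \<le> T2" using T1 T2 by linarith
      show "wp (index_code ;; potential_code ;; start_code ;; search_code) T2 C2 R2 A2 (\<lambda>_. ?Q)"
      proof (rule wp_Call_Seq[OF wp_index_code])
        show "R2 0 = k" "R2 3 = V" "R2 4 = k * V" "R2 5 = size_in" "R2 7 = 1"
          using 2(3) by (auto simp: env_def)
        show "?T3 \<le> T2" using T2 by linarith
        fix T3 C3 R3 A3
        assume T3: "T2 - ?T3 \<le> T3" and "C3 = C2 \<and> index_arrays (k * V) A3 \<and> agree {0, 1, 2, 3} A3 A2 \<and>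
          agree {11, 12, 13, 14, 15, 16} R3 R2"
        then have 3: "has_table C3" "index_arrays (k * V) A3" "\<And>i. A3 6 i = 0" "env R3" "R3 8 = 0"
          using 2 assms(4) by (auto simp: env_def agree_def)
        have T3: "?T4 + ?T5 + ?T6 \<le> T3" using T2 T3 by linarith
        show "wp (potential_code ;; start_code ;; search_code) T3 C3 R3 A3 (\<lambda>_. ?Q)"
        proof (rule wp_Call_Seq[OF wp_potential_code[OF 3(4,2,1,5)]])
          show "?T4 \<le> T3" using T3 by linarith
          fix T4 C4 R4 A4
          assume T4: "T3 - ?T4 \<le> T4" and "has_table C4 \<and> R4 8 = (if unit_cycles then 0 else 1) \<and> A4 = A3 \<and>
            agree {8, 11, 18, 19, 20, 21, 27} R4 R3"
          then have 4: "has_table C4" "A4 = A3" "env R4" "R4 8 = (if \<not> unit_cycles then 1 else 0)"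
            using 3 by (auto simp: env_def agree_def)
          have T4: "?T5 + ?T6 \<le> T4" using T3 T4 by linarith
          show "wp (start_code ;; search_code) T4 C4 R4 A4 (\<lambda>_. ?Q)"
          proof (rule wp_Call_Seq[OF wp_start_code[OF 4(3,1) _ _ 4(4)]])
            show "index_arrays (k * V) A4" using 3 4 by simp
            show "A4 6 i = 0" for i using 3 4 by simp
            show "?T5 \<le> T4" using T4 by linarith
            fix T5 C5 R5 A5
            assume T5: "T4 - ?T5 \<le> T5" and "C5 = C4 \<and> agree {9, 11, 12} R5 R4 \<and>
              queue (search 0 (\<not> unit_cycles)) R5 A5"
            then have 5: "has_table C5" "env R5" "queue (search 0 (\<not> unit_cycles)) R5 A5"
              using 4 by (auto simp: env_def agree_def)
            have T5: "?T6 \<le> T5" using T4 T5 by linarith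
            show "wp search_code T5 C5 R5 A5 (\<lambda>_. ?Q)"
              by (rule wp_conseq[OF wp_search_code[OF 5(2,1,3)] T5]) (auto simp: well_formed_iff)
          qed
        qed
      qed
    qed
  qed
  have S4: "S - 1 - 1 - 2 = S - 4" by simp
  have "wp (power_code ;; copy_code ;; index_code ;; potential_code ;; start_code ;; search_code)
    (S - 1 - 1 - 2) C ?R A (\<lambda>_. ?Q)" unfolding S4 by (rule big)
  moreover have "4 \<le> S" using S by linarith
  moreover have "\<not> holds (TLe 0 7) C ?R" using assms(1) two_states by simp
  ultimately have "wp main_code S C R A (\<lambda>_. ?Q)"
    unfolding main_code_def
    by - (rule wp_Prim_Seq, simp, simp, simp only: prim_c.simps prim_n.simps,
      rule wp_Prim_Seq, simp, simp, simp only: prim_c.simps prim_n.simps,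
      rule wp_If_false, assumption, assumption, simp_all)
  then show ?thesis by (simp only: S_def)
qed

end

theorem theorem2:
  shows "\<exists>(prog :: instr list) (C :: nat).
    \<forall>k r q \<delta> (a :: int). is_LQCA k r q \<delta> \<longrightarrow>
      (\<exists>t \<le> C * (k ^ (r + 1))\<^sup>2.
         out ((step prog ^^ t) (init k r q \<delta>)) = Some (well_formed k q a r \<delta>))"
\<comment> \<open>The constant is 500 for \<open>main_code\<close> plus 3 for the closing test and
  the halt, absorbed because the squared input size is at least 1.\<close>
proof (rule exI[of _ decide], rule exI[of _ 503], intro allI impI)
  fix k r q :: nat and \<delta> :: "nat list \<Rightarrow> nat \<Rightarrow> complex" and a :: int
  assume A: "is_LQCA k r q \<delta>"
  let ?N = "nreg (init k r q \<delta>)" and ?C = "creg (init k r q \<delta>)"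
  have init: "init k r q \<delta> = mst 0 ?C ?N" by (simp add: init_def)
  have rep: "rep ?N ?N (\<lambda>_ _. 0)" by (simp add: rep_def init_def)
  have k1: "1 \<le> k" using A by (simp add: is_LQCA_def)
  have "wp main_code (500 * (k ^ (r + 1))\<^sup>2) ?C ?N (\<lambda>_ _. 0)
    (\<lambda>_ C' R' A'. R' 8 = (if well_formed k q a r \<delta> then 0 else 1))"
  proof (cases "k = 1")
    case True
    then have "well_formed k q a r \<delta>" using A well_formed_single_state by simp
    then show ?thesis using True
      unfolding main_code_def
      by - (rule wp_Prim_Seq, simp, simp, rule wp_Prim_Seq, simp, simp,
        rule wp_If_true, simp_all add: init_def wp_Skip)
  next
    case False
    then interpret lqca k r q \<delta> using A k1 by unfold_locales auto
    show ?thesis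
      unfolding size_in_power[symmetric]
      by (rule wp_main_code) (simp_all add: init_def table_def size_in_power)
  qed
  from wp_decide[OF this rep] obtain t where t: "t \<le> 500 * (k ^ (r + 1))\<^sup>2 + 3"
    "out ((step decide ^^ t) (init k r q \<delta>)) = Some (well_formed k q a r \<delta>)"
    using init by metis
  have "1 \<le> (k ^ (r + 1))\<^sup>2" using k1 by simp
  then have "t \<le> 503 * (k ^ (r + 1))\<^sup>2" using t(1) by linarith
  then show "\<exists>t\<le>503 * (k ^ (r + 1))\<^sup>2.
      out ((step decide ^^ t) (init k r q \<delta>)) = Some (well_formed k q a r \<delta>)"
    using t(2) by blast
qed

end
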